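(* For every $n\ge3$, the braid group $B_n$ and the pure braid group $PB_n$ (on $n$ strands) are not $\mathrm{UB}$-flexibly BS-rigid.
   Context: Write $[r]=\{1,\dots,r\}$ and $\mathrm{Sym}(r)$ for the symmetric group on $[r]$. For $\sigma\in\mathrm{Sym}(r)$ and $\tau\in\mathrm{Sym}(R)$ with $R\ge r$, $d(\sigma,\tau)=d(\tau,\sigma)=\frac1r|\{x\in[r]\mid\sigma x\neq\tau x\}|$. For a group $\Gamma$, $f\colon\Gamma\to\mathrm{Sym}(r)$ and finite $Q\subset\Gamma$, $N_{f,Q}$ is the distribution on $2^Q$ of $\{\gamma\in Q\mid f(\gamma)x=x\}$ with $x$ uniform in $[r]$; $d_{\mathrm{TV}}$ is total variation distance (half the $\ell^1$ distance). A group $\Gamma$ is UB-flexibly (unboundedly flexibly) BS-rigid if for every sequence of functions $(f_\ell\colon\Gamma\to\mathrm{Sym}(n_\ell))_{\ell=1}^\infty$ with $n_\ell\to\infty$ and $d(f_\ell(\gamma_1\gamma_2),f_\ell(\gamma_1)f_\ell(\gamma_2))\to0$ for all $\gamma_1,\gamma_2\in\Gamma$: if there is a sequence of homomorphisms $(g_\ell\colon\Gamma\to\mathrm{Sym}(n_\ell))_{\ell=1}^\infty$ with $d_{\mathrm{TV}}(N_{f_\ell,Q},N_{g_\ell,Q})\to0$ for every finite $Q\subset\Gamma$, then there are homomorphisms $(h_\ell\colon\Gamma\to\mathrm{Sym}(N_\ell))_{\ell=1}^\infty$ with $n_\ell\le N_\ell<\infty$ (no other bound on $N_\ell$) such that $d(f_\ell(\gamma),h_\ell(\gamma))\to0$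 for all $\gamma\in\Gamma$. *)

theory Defs
  imports
    "HOL-Algebra.Sym_Groups"
    "HOL-Probability.Probability_Mass_Function"
begin

section \<open>Braid groups\<close>

text \<open>
  Artin's presentation: generators \<open>\<sigma>\<^sub>1, \<dots>, \<sigma>\<^sub>n\<^sub>-\<^sub>1\<close>, with relations
  \<open>\<sigma>\<^sub>i \<sigma>\<^sub>j = \<sigma>\<^sub>j \<sigma>\<^sub>i\<close> for \<open>\<bar>i - j\<bar> \<ge> 2\<close> and
  \<open>\<sigma>\<^sub>i \<sigma>\<^sub>i\<^sub>+\<^sub>1 \<sigma>\<^sub>i = \<sigma>\<^sub>i\<^sub>+\<^sub>1 \<sigma>\<^sub>i \<sigma>\<^sub>i\<^sub>+\<^sub>1\<close>. The letter \<open>(i, True)\<close> stands for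
  \<open>\<sigma>\<^sub>i\<close> and \<open>(i, False)\<close> for its formal inverse.
\<close>

type_synonym braid_word = "(nat \<times> bool) list"

definition braid_words :: "nat \<Rightarrow> braid_word set" where
  "braid_words n = lists ({1..<n} \<times> UNIV)"

inductive braid_eq :: "nat \<Rightarrow> braid_word \<Rightarrow> braid_word \<Rightarrow> bool" for n :: nat where
  refl: "w \<in> braid_words n \<Longrightarrow> braid_eq n w w"
| sym: "braid_eq n u v \<Longrightarrow> braid_eq n v u"
| trans: "braid_eq n u v \<Longrightarrow> braid_eq n v w \<Longrightarrow> braid_eq n u w"
| append: "braid_eq n u u' \<Longrightarrow> braid_eq n v v' \<Longrightarrow> braid_eq n (u @ v) (u' @ v')"
| cancel: "i \<in> {1..<n} \<Longrightarrow> braid_eq n [(i, b), (i, \<not> b)] []"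
| commute: "i \<in> {1..<n} \<Longrightarrow> j \<in> {1..<n} \<Longrightarrow> i + 2 \<le> j \<Longrightarrow>
    braid_eq n [(i, True), (j, True)] [(j, True), (i, True)]"
| braid: "i \<in> {1..<n} \<Longrightarrow> i + 1 \<in> {1..<n} \<Longrightarrow>
    braid_eq n [(i, True), (i + 1, True), (i, True)] [(i + 1, True), (i, True), (i + 1, True)]"

definition braid_rel :: "nat \<Rightarrow> (braid_word \<times> braid_word) set" where
  "braid_rel n = {(u, v). braid_eq n u v}"

definition braid_group :: "nat \<Rightarrow> braid_word set monoid" where
  "braid_group n =
    \<lparr> carrier = braid_words n // braid_rel n,
      mult = (\<lambda>X Y. \<Union>u\<in>X. \<Union>v\<in>Y. braid_rel n `` {u @ v}),
      one = braid_rel n `` {[]} \<rparr>"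

text \<open>
  The permutation of the strands induced by a braid; it is constant on each class
  (lemma \<open>braid_eq_word_perm\<close>), so that the image below is a singleton.
\<close>

definition braid_word_perm :: "braid_word \<Rightarrow> nat \<Rightarrow> nat" where
  "braid_word_perm w = foldr (\<lambda>(i, b) p. Transposition.transpose i (Suc i) \<circ> p) w id"

definition braid_perm :: "braid_word set \<Rightarrow> nat \<Rightarrow> nat" where
  "braid_perm X = the_elem (braid_word_perm ` X)"

definition pure_braid_group :: "nat \<Rightarrow> braid_word set monoid" where
  "pure_braid_group n =
    (braid_group n)\<lparr>carrier := kernel (braid_group n) (sym_group n) braid_perm\<rparr>"


subsection \<open>Well-definedness\<close>

lemma braid_eq_words: "braid_eq n u v \<Longrightarrow> u \<in> braid_words n \<and> v \<in> braid_words n"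
  by (induction rule: braid_eq.induct) (auto simp: braid_words_def)

lemma equiv_braid_rel: "equiv (braid_words n) (braid_rel n)"
  by (rule equivI)
    (auto simp: braid_rel_def refl_on_def sym_def trans_def
      intro: braid_eq.intros dest: braid_eq_words)

lemma braid_group_carrierE:
  assumes "X \<in> carrier (braid_group n)"
  obtains u where "u \<in> braid_words n" "X = braid_rel n `` {u}"
  using assms by (auto simp: braid_group_def elim: quotientE)

lemma braid_class_in_carrier:
  "u \<in> braid_words n \<Longrightarrow> braid_rel n `` {u} \<in> carrier (braid_group n)"
  by (auto simp: braid_group_def intro: quotientI)

lemma braid_class_eqI: "braid_eq n u v \<Longrightarrow> braid_rel n `` {u} = braid_rel n `` {v}"
  by (rule equiv_class_eq[OF equiv_braid_rel]) (simp add: braid_rel_def)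

lemma braid_group_mult:
  assumes "u \<in> braid_words n" "v \<in> braid_words n"
  shows "braid_rel n `` {u} \<otimes>\<^bsub>braid_group n\<^esub> braid_rel n `` {v} = braid_rel n `` {u @ v}"
proof -
  have "braid_rel n `` {u' @ v'} = braid_rel n `` {u @ v}"
    if "u' \<in> braid_rel n `` {u}" "v' \<in> braid_rel n `` {v}" for u' v'
    using that by (intro braid_class_eqI) (auto simp: braid_rel_def intro: braid_eq.intros)
  moreover have "u \<in> braid_rel n `` {u}" "v \<in> braid_rel n `` {v}"
    using assms by (auto simp: braid_rel_def intro: braid_eq.refl)
  ultimately show ?thesis
    unfolding braid_group_def monoid.simps by blast
qed

lemma braid_eq_inverse:
  "w \<in> braid_words n \<Longrightarrow> braid_eq n (rev (map (\<lambda>(i, b). (i, \<not> b)) w) @ w) []"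
proof (induction w)
  case Nil
  then show ?case by (auto intro: braid_eq.refl)
next
  case (Cons a w)
  obtain i b where a: "a = (i, b)" by force
  let ?w' = "rev (map (\<lambda>(i, b). (i, \<not> b)) w)"
  have w: "w \<in> braid_words n" and i: "i \<in> {1..<n}"
    using Cons.prems a by (auto simp: braid_words_def)
  have w': "?w' \<in> braid_words n"
    using w by (force simp: braid_words_def in_lists_conv_set)
  have "braid_eq n [(i, \<not> b), (i, b)] []"
    using braid_eq.cancel[OF i, of "\<not> b"] by simp
  then have "braid_eq n (?w' @ [(i, \<not> b), (i, b)] @ w) (?w' @ [] @ w)"
    using w w' by (blast intro: braid_eq.append braid_eq.refl)
  then show ?case
    using Cons.IH[OF w] a by (auto intro: braid_eq.trans)
qed

lemma group_braid_group: "group (braid_group n)"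
proof (rule groupI)
  show one: "\<one>\<^bsub>braid_group n\<^esub> \<in> carrier (braid_group n)"
    by (auto simp: braid_group_def braid_words_def intro: quotientI)
  have one_eq: "\<one>\<^bsub>braid_group n\<^esub> = braid_rel n `` {[]}"
    by (simp add: braid_group_def)
  have Nil: "[] \<in> braid_words n" by (simp add: braid_words_def)
  have app: "u @ v \<in> braid_words n" if "u \<in> braid_words n" "v \<in> braid_words n" for u v
    using that by (simp add: braid_words_def)
  fix X Y assume X: "X \<in> carrier (braid_group n)" and Y: "Y \<in> carrier (braid_group n)"
  obtain u where u: "u \<in> braid_words n" "X = braid_rel n `` {u}"
    using X by (rule braid_group_carrierE)
  obtain v where v: "v \<in> braid_words n" "Y = braid_rel n `` {v}"
    using Y by (rule braid_group_carrierE)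
  show "X \<otimes>\<^bsub>braid_group n\<^esub> Y \<in> carrier (braid_group n)"
    using u v by (simp add: braid_group_mult braid_class_in_carrier app)
  show "\<one>\<^bsub>braid_group n\<^esub> \<otimes>\<^bsub>braid_group n\<^esub> X = X"
    using u by (simp add: one_eq braid_group_mult Nil)
  let ?u' = "rev (map (\<lambda>(i, b). (i, \<not> b)) u)"
  have u': "?u' \<in> braid_words n"
    using u by (force simp: braid_words_def in_lists_conv_set)
  have "braid_rel n `` {?u'} \<otimes>\<^bsub>braid_group n\<^esub> X = \<one>\<^bsub>braid_group n\<^esub>"
    using u u' braid_class_eqI[OF braid_eq_inverse[OF u(1)]]
    by (simp add: braid_group_mult one_eq)
  then show "\<exists>Z\<in>carrier (braid_group n). Z \<otimes>\<^bsub>braid_group n\<^esub> X = \<one>\<^bsub>braid_group n\<^esub>"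
    using u' braid_class_in_carrier by blast
  fix Z assume Z: "Z \<in> carrier (braid_group n)"
  obtain w where w: "w \<in> braid_words n" "Z = braid_rel n `` {w}"
    using Z by (rule braid_group_carrierE)
  show "X \<otimes>\<^bsub>braid_group n\<^esub> Y \<otimes>\<^bsub>braid_group n\<^esub> Z =
      X \<otimes>\<^bsub>braid_group n\<^esub> (Y \<otimes>\<^bsub>braid_group n\<^esub> Z)"
    using u v w by (simp add: braid_group_mult app)
qed

lemma braid_word_perm_append: "braid_word_perm (u @ v) = braid_word_perm u \<circ> braid_word_perm v"
  by (induction u) (auto simp: braid_word_perm_def o_assoc[symmetric])

lemma braid_eq_word_perm: "braid_eq n u v \<Longrightarrow> braid_word_perm u = braid_word_perm v"
proof (induction rule: braid_eq.induct)
  case (append u u' v v')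
  then show ?case by (simp add: braid_word_perm_append)
qed (auto simp: braid_word_perm_def fun_eq_iff Transposition.transpose_def)

lemma braid_perm_class:
  assumes "u \<in> braid_words n"
  shows "braid_perm (braid_rel n `` {u}) = braid_word_perm u"
proof -
  have "braid_word_perm ` (braid_rel n `` {u}) = {braid_word_perm u}"
    using assms by (force simp: braid_rel_def dest: braid_eq_word_perm intro: braid_eq.refl)
  then show ?thesis by (simp add: braid_perm_def)
qed

lemma braid_word_perm_permutes:
  "w \<in> braid_words n \<Longrightarrow> braid_word_perm w permutes {1..n}"
proof (induction w)
  case Nil
  have "braid_word_perm [] = id" by (simp add: braid_word_perm_def)
  then show ?case using permutes_id by metis
next
  case (Cons a w)
  then show ?case
    by (auto simp: braid_words_def braid_word_perm_def
        intro!: permutes_compose permutes_swap_id)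
qed

lemma braid_perm_hom: "braid_perm \<in> hom (braid_group n) (sym_group n)"
proof (rule homI)
  fix X Y assume X: "X \<in> carrier (braid_group n)" and Y: "Y \<in> carrier (braid_group n)"
  obtain u where u: "u \<in> braid_words n" "X = braid_rel n `` {u}"
    using X by (rule braid_group_carrierE)
  obtain v where v: "v \<in> braid_words n" "Y = braid_rel n `` {v}"
    using Y by (rule braid_group_carrierE)
  show "braid_perm X \<in> carrier (sym_group n)"
    using u braid_word_perm_permutes[OF u(1)]
    by (simp only: braid_perm_class sym_group_carrier)
  have "u @ v \<in> braid_words n" using u v by (simp add: braid_words_def)
  then show "braid_perm (X \<otimes>\<^bsub>braid_group n\<^esub> Y) =
      braid_perm X \<otimes>\<^bsub>sym_group n\<^esub> braid_perm Y"
    using u v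
    by (simp add: braid_group_mult braid_perm_class braid_word_perm_append sym_group_mult)
qed

lemma group_pure_braid_group: "group (pure_braid_group n)"
proof -
  interpret group_hom "braid_group n" "sym_group n" braid_perm
    by (intro group_hom.intro group_hom_axioms.intro group_braid_group sym_group_is_group
        braid_perm_hom)
  show ?thesis
    unfolding pure_braid_group_def
    using subgroup_kernel by (rule G.subgroup_imp_group)
qed


section \<open>Flexible BS-rigidity\<close>

text \<open>
  A permutation of \<open>{1..r}\<close> is a function on all of \<^typ>\<open>nat\<close>, so its degree has to be
  given separately: in \<open>perm_dist r \<sigma> \<tau>\<close>, the number \<open>r\<close> is the smaller of the degrees of
  \<open>\<sigma>\<close> and \<open>\<tau>\<close>.
\<close>

definition perm_dist :: "nat \<Rightarrow> (nat \<Rightarrow> nat) \<Rightarrow> (nat \<Rightarrow> nat) \<Rightarrow> real" where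
  "perm_dist r \<sigma> \<tau> = real (card {x \<in> {1..r}. \<sigma> x \<noteq> \<tau> x}) / real r"

definition stab_pmf :: "nat \<Rightarrow> ('a \<Rightarrow> nat \<Rightarrow> nat) \<Rightarrow> 'a set \<Rightarrow> 'a set pmf" where
  "stab_pmf r f Q = map_pmf (\<lambda>x. {\<gamma> \<in> Q. f \<gamma> x = x}) (pmf_of_set {1..r})"

text \<open>Total variation distance of two distributions on the finite set \<open>A\<close>.\<close>

definition tv_dist :: "'b set \<Rightarrow> 'b pmf \<Rightarrow> 'b pmf \<Rightarrow> real" where
  "tv_dist A p q = (\<Sum>a\<in>A. \<bar>pmf p a - pmf q a\<bar>) / 2"

definition almost_hom_seq ::
    "('a, 'b) monoid_scheme \<Rightarrow> (nat \<Rightarrow> nat) \<Rightarrow> (nat \<Rightarrow> 'a \<Rightarrow> nat \<Rightarrow> nat) \<Rightarrow> bool" where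
  "almost_hom_seq G n f \<longleftrightarrow>
    (\<forall>l. n l \<ge> 1) \<and> filterlim n at_top sequentially \<and>
    (\<forall>l. f l \<in> carrier G \<rightarrow> carrier (sym_group (n l))) \<and>
    (\<forall>x\<in>carrier G. \<forall>y\<in>carrier G.
      (\<lambda>l. perm_dist (n l) (f l (x \<otimes>\<^bsub>G\<^esub> y)) (f l x \<circ> f l y)) \<longlonglongrightarrow> 0)"

definition UB_flexibly_BS_rigid :: "('a, 'b) monoid_scheme \<Rightarrow> bool" where
  "UB_flexibly_BS_rigid G \<longleftrightarrow>
    (\<forall>n f. almost_hom_seq G n f \<longrightarrow>
      (\<exists>g. (\<forall>l. g l \<in> hom G (sym_group (n l))) \<and>
           (\<forall>Q. finite Q \<and> Q \<subseteq> carrier G \<longrightarrow>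
              (\<lambda>l. tv_dist (Pow Q) (stab_pmf (n l) (f l) Q) (stab_pmf (n l) (g l) Q)) \<longlonglongrightarrow> 0)) \<longrightarrow>
      (\<exists>N h. (\<forall>l. n l \<le> N l) \<and> (\<forall>l. h l \<in> hom G (sym_group (N l))) \<and>
             (\<forall>x\<in>carrier G. (\<lambda>l. perm_dist (n l) (f l x) (h l x)) \<longlonglongrightarrow> 0)))"

end

theory Submission
  imports Defs "HOL-Number_Theory.Cong"
begin

text \<open>
  The pure braids \<open>x = \<sigma>\<^sub>1\<^sup>2\<close>, \<open>y = \<sigma>\<^sub>1\<^sup>-\<^sup>1 \<sigma>\<^sub>2\<^sup>2 \<sigma>\<^sub>1\<close> and \<open>t = (\<sigma>\<^sub>2 \<sigma>\<^sub>1)\<^sup>3\<close> generate a copy of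
  \<open>F\<^sub>2 \<times> \<int>\<close>, and the permutations of three marked strands turn any pair \<open>A, B\<close> almost
  commuting with \<open>T\<close> into an almost action of the whole braid group, in which \<open>x, y, t\<close> act as
  \<open>A, B, T\<close> on one block of fixed proportion. Conjugating \<open>y\<close> by powers of \<open>x\<close> gives as many free
  generators as we like. All but one of them commute exactly with \<open>T\<close> and expand on an extension
  \<open>Y \<times> \<int>/p\<close> of a finite expander on which \<open>T\<close> is the shift of \<open>\<int>/p\<close>; the last one
  moves a further bit on half of \<open>\<int>/p\<close> only, so it commutes with \<open>T\<close> up to \<open>O(1/p)\<close> but not
  with \<open>T\<^sup>k\<close> for \<open>k\<close> about \<open>p/2\<close>.

  If a true action \<open>h\<close> on a set of any size, containing the given one, is near the almost action, then for every
  \<open>k\<close> the set where \<open>h(t)\<^sup>k\<close> agrees with \<open>T\<^sup>k\<close> is almost invariant under the expanding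
  generators, hence nearly empty or nearly everything, and by induction on \<open>k\<close> it is nearly
  everything, uniformly in \<open>k\<close>. Then the last generator almost commutes with all \<open>T\<^sup>k\<close>,
  a contradiction.

  Replacing \<open>T\<close> by the shift of another, inert coordinate gives a true action of the same degree.
  It has the same fixed point statistics because the cocycle of the extension is multiplied by a
  scalar \<open>q\<close> that is itself a coordinate of the point: for random \<open>q\<close> it rarely takes a
  prescribed non-zero value.
\<close>

section \<open>Expanders from random permutations\<close>

lemma ex_permutes_image_eq:
  assumes "finite V" "A \<subseteq> V" "B \<subseteq> V" "card A = card B"
  shows "\<exists>\<rho>. \<rho> permutes V \<and> \<rho> ` A = B"
proof -
  have fin: "finite A" "finite B" using assms finite_subset by auto
  obtain f where f: "bij_betw f A B"
    using finite_same_card_bij[OF fin assms(4)] by blast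
  have "card (V - A) = card (V - B)"
    using assms fin by (simp add: card_Diff_subset)
  then obtain g where g: "bij_betw g (V - A) (V - B)"
    using finite_same_card_bij[of "V - A" "V - B"] assms(1) by auto
  define h where "h x = (if x \<in> A then f x else if x \<in> V then g x else x)" for x
  have hA: "bij_betw h A B"
    using f by (rule bij_betw_cong[THEN iffD1, rotated]) (simp add: h_def)
  have hD: "bij_betw h (V - A) (V - B)"
    using g by (rule bij_betw_cong[THEN iffD1, rotated]) (simp add: h_def)
  have "bij_betw h (A \<union> (V - A)) (B \<union> (V - B))"
    by (rule bij_betw_combine[OF hA hD]) auto
  then have "bij_betw h V V"
    using assms by (simp add: Un_absorb1)
  then have "h permutes V"
    by (rule bij_imp_permutes) (use assms in \<open>auto simp: h_def\<close>)
  then show ?thesis using hA by (auto simp: bij_betw_def)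
qed

text \<open>Composing with a permutation that carries one target set to another injects one fibre
  into the other. So all fibres over the subsets of \<open>V\<close> with \<open>card A\<close>
  elements have the same size, and they partition the permutations of \<open>V\<close>.\<close>

lemma card_permutes_image_eq:
  assumes "finite V" "A \<subseteq> V" "B \<subseteq> V" "card A = card B"
  shows "card {\<pi>. \<pi> permutes V \<and> \<pi> ` A = B} * (card V choose card A) = fact (card V)"
proof -
  let ?P = "\<lambda>B. {\<pi>. \<pi> permutes V \<and> \<pi> ` A = B}"
  let ?S = "{C. C \<subseteq> V \<and> card C = card A}"
  have finA: "finite A" using assms finite_subset by auto
  have finP: "finite (?P C)" for C
    by (rule finite_subset[OF _ finite_permutations[OF assms(1)]]) auto
  have le: "card (?P C) \<le> card (?P D)" if CD: "C \<in> ?S" "D \<in> ?S" for C D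
  proof -
    obtain \<rho> where \<rho>: "\<rho> permutes V" "\<rho> ` C = D"
      using CD ex_permutes_image_eq[OF assms(1), of C D] by auto
    have "inj \<rho>" using \<rho>(1) permutes_inj by blast
    show ?thesis
    proof (rule card_inj_on_le[OF _ _ finP])
      show "inj_on (\<lambda>\<pi>. \<rho> \<circ> \<pi>) (?P C)"
        using \<open>inj \<rho>\<close> by (auto simp: inj_on_def fun_eq_iff)
      show "(\<lambda>\<pi>. \<rho> \<circ> \<pi>) ` ?P C \<subseteq> ?P D"
        using \<rho> by (auto simp: image_comp[symmetric] intro: permutes_compose)
    qed
  qed
  have B: "B \<in> ?S" using assms by auto
  have eq: "card (?P C) = card (?P B)" if "C \<in> ?S" for C
    using le[OF that B] le[OF B that] by simp
  have "{\<pi>. \<pi> permutes V} = (\<Union>C\<in>?S. ?P C)"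
  proof (intro equalityI subsetI)
    fix \<pi> assume "\<pi> \<in> {\<pi>. \<pi> permutes V}"
    then have \<pi>: "\<pi> permutes V" by simp
    have "\<pi> ` A \<subseteq> V" using assms(2) permutes_image[OF \<pi>] by blast
    moreover have "card (\<pi> ` A) = card A"
      by (intro card_image inj_on_subset[OF permutes_inj[OF \<pi>]]) simp
    ultimately show "\<pi> \<in> (\<Union>C\<in>?S. ?P C)" using \<pi> by blast
  qed blast
  then have "fact (card V) = card (\<Union>C\<in>?S. ?P C)"
    using card_permutations[OF HOL.refl assms(1)] by simp
  also have "\<dots> = (\<Sum>C\<in>?S. card (?P C))"
    by (rule card_UN_disjoint) (use assms(1) finP in auto)
  also have "\<dots> = card ?S * card (?P B)" using eq by simp
  also have "card ?S = card V choose card A" using n_subsets[OF assms(1)] by simp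
  finally show ?thesis by simp
qed

lemma card_permutes_image_subset:
  assumes "finite V" "A \<subseteq> V" "B \<subseteq> V"
  shows "card {\<pi>. \<pi> permutes V \<and> \<pi> ` A \<subseteq> B} * (card V choose card A)
    = (card B choose card A) * fact (card V)"
proof -
  let ?P = "\<lambda>B. {\<pi>. \<pi> permutes V \<and> \<pi> ` A = B}"
  let ?S = "{C. C \<subseteq> B \<and> card C = card A}"
  have finB: "finite B" using assms finite_subset by auto
  have finP: "finite (?P C)" for C
    by (rule finite_subset[OF _ finite_permutations[OF assms(1)]]) auto
  have "{\<pi>. \<pi> permutes V \<and> \<pi> ` A \<subseteq> B} = (\<Union>C\<in>?S. ?P C)"
    by (auto intro: card_image inj_on_subset[OF permutes_inj])
  then have "card {\<pi>. \<pi> permutes V \<and> \<pi> ` A \<subseteq> B} = card (\<Union>C\<in>?S. ?P C)" by simp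
  also have "\<dots> = (\<Sum>C\<in>?S. card (?P C))"
    by (rule card_UN_disjoint) (use finB finP in auto)
  finally have "card {\<pi>. \<pi> permutes V \<and> \<pi> ` A \<subseteq> B} * (card V choose card A) =
     (\<Sum>C\<in>?S. card (?P C) * (card V choose card A))"
    by (simp add: sum_distrib_right)
  also have "\<dots> = (\<Sum>C\<in>?S. fact (card V))"
  proof (rule sum.cong[OF HOL.refl])
    fix C assume "C \<in> ?S"
    then show "card (?P C) * (card V choose card A) = fact (card V)"
      using assms(3) by (intro card_permutes_image_eq[OF assms(1,2)]) auto
  qed
  also have "\<dots> = (card B choose card A) * fact (card V)"
    using n_subsets[OF finB] by simp
  finally show ?thesis .
qed

text \<open>A single term of the expansion of \<open>(1 + 1/2560) ^ (2560 * m)\<close>, which is at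
  most \<open>exp m\<close>, already bounds the coefficient by \<open>(3 * 2560) ^ m\<close>;
  \<open>65536\<close> is a convenient power of two above that base.\<close>

lemma binomial_2560_le_power:
  "(2560 * m) choose m \<le> 65536 ^ m"
proof -
  let ?M = "2560 * m"
  let ?x = "1 / 2560 :: real"
  have "real (?M choose m) * ?x ^ m \<le> (\<Sum>k\<le>?M. real (?M choose k) * ?x ^ k)"
    by (rule member_le_sum) auto
  also have "\<dots> = (?x + 1) ^ ?M"
    using binomial_ring[of ?x "1::real" ?M] by simp
  also have "\<dots> \<le> exp ?x ^ ?M"
    by (rule power_mono) (use exp_ge_add_one_self[of ?x] in auto)
  also have "\<dots> = exp (real m)"
    using exp_of_nat_mult[of ?M ?x] by simp
  also have "\<dots> = exp 1 ^ m"
    using exp_of_nat_mult[of m "1::real"] by simp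
  also have "\<dots> \<le> 3 ^ m" by (rule power_mono) (use exp_le in auto)
  finally have "real (?M choose m) \<le> 3 ^ m * 2560 ^ m"
    by (simp add: power_divide field_simps)
  also have "\<dots> = (7680::real) ^ m" by (simp add: power_mult_distrib[symmetric])
  also have "\<dots> \<le> 65536 ^ m" by (rule power_mono) auto
  finally have "real (?M choose m) \<le> real (65536 ^ m)" by simp
  then show ?thesis by linarith
qed

text \<open>
  The two binomial coefficients that count the choices of at most \<open>m\<close> escaping points are at most
  \<open>2^(16 m)\<close> each, against a gain of \<open>2^(64 m)\<close> from the size of \<open>A\<close>; this leaves enough for a
  union bound over all \<open>2^(2560 m)\<close> sets \<open>A\<close> as soon as there are \<open>r > 80\<close> permutations.
\<close>

lemma card_nearly_invariant_permutes:
  fixes m :: nat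
  defines "V \<equiv> {..<2560 * m}"
  assumes A: "A \<subseteq> V" "64 * m \<le> card A" "2 * card A \<le> 2560 * m"
  shows "card {\<pi>. \<pi> permutes V \<and> card (\<pi> ` A - A) \<le> m} * 2 ^ (32 * m) \<le> fact (2560 * m)"
    (is "card ?bad * _ \<le> _")
proof -
  let ?M = "2560 * m"
  let ?S = "{D. D \<subseteq> V \<and> card D = m}"
  let ?P = "\<lambda>D. {\<pi>. \<pi> permutes V \<and> \<pi> ` A \<subseteq> A \<union> D}"
  have finV: "finite V" and cV: "card V = ?M" by (auto simp: V_def)
  have finA: "finite A" using A finV finite_subset by auto
  have finP: "finite (?P D)" for D
    by (rule finite_subset[OF _ finite_permutations[OF finV]]) auto
  have finS: "finite ?S" using finV by simp
  \<comment> \<open>The escaping points, at most \<open>m\<close> of them, are padded to a set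
    \<open>D\<close> of exactly \<open>m\<close> points.\<close>
  have "?bad \<subseteq> (\<Union>D\<in>?S. ?P D)"
  proof
    fix \<pi> assume \<pi>: "\<pi> \<in> ?bad"
    have "\<pi> ` A - A \<subseteq> V" using \<pi> A(1) permutes_in_image by fastforce
    then obtain D where "\<pi> ` A - A \<subseteq> D" "D \<subseteq> V" "card D = m"
      using exists_subset_between[of "\<pi> ` A - A" m V] \<pi> finV cV by auto
    then show "\<pi> \<in> (\<Union>D\<in>?S. ?P D)" using \<pi> by auto
  qed
  then have "card ?bad \<le> card (\<Union>D\<in>?S. ?P D)"
    using finS finP by (intro card_mono) auto
  also have "\<dots> \<le> (\<Sum>D\<in>?S. card (?P D))" by (rule card_UN_le[OF finS])
  finally have "card ?bad \<le> (\<Sum>D\<in>?S. card (?P D))" .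
  then have "card ?bad * (?M choose card A) \<le> (\<Sum>D\<in>?S. card (?P D) * (?M choose card A))"
    unfolding sum_distrib_right[symmetric] by (rule mult_le_mono1)
  also have "\<dots> \<le> (\<Sum>D\<in>?S. (?M choose m) * fact ?M)"
  proof (rule sum_mono)
    fix D assume D: "D \<in> ?S"
    have cle: "card (A \<union> D) \<le> card A + m" using D card_Un_le[of A D] by simp
    have "card (A \<union> D) choose card A \<le> (card A + m) choose card A"
      using cle by (rule binomial_right_mono)
    also have "\<dots> = (card A + m) choose m" using binomial_symmetric[of m "card A + m"] by simp
    also have "\<dots> \<le> ?M choose m" using A(2,3) by (intro binomial_right_mono) linarith
    finally have "(card (A \<union> D) choose card A) * fact ?M \<le> (?M choose m) * fact ?M" by simp
    then show "card (?P D) * (?M choose card A) \<le> (?M choose m) * fact ?M"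
      using card_permutes_image_subset[OF finV A(1), of "A \<union> D"] D A(1) cV by simp
  qed
  also have "\<dots> = (?M choose m) * ((?M choose m) * fact ?M)"
    using n_subsets[OF finV, of m] cV by simp
  also have "\<dots> \<le> 65536 ^ m * (65536 ^ m * fact ?M)"
    using binomial_2560_le_power[of m] by (intro mult_le_mono) auto
  also have "\<dots> = 2 ^ (32 * m) * fact ?M"
    by (simp add: power_mult mult.assoc[symmetric] power_mult_distrib[symmetric])
  finally have 1: "card ?bad * (?M choose card A) \<le> 2 ^ (32 * m) * fact ?M" .
  \<comment> \<open>This is the gain: \<open>card A\<close> factors, at least \<open>64 * m\<close>
    of them, each at least 2 because \<open>A\<close> fills at most half of
    \<open>V\<close>.\<close>
  have "2 ^ (64 * m) \<le> ?M choose card A"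
  proof (cases "m = 0")
    case False
    have "(2::real) ^ (64 * m) \<le> 2 ^ card A" using A(2) by (intro power_increasing) auto
    also have "\<dots> \<le> (real ?M / real (card A)) ^ card A"
    proof (rule power_mono)
      have "real (2 * card A) \<le> real ?M" using A(3) by (simp only: of_nat_le_iff)
      then show "2 \<le> real ?M / real (card A)" using A(2) False by (simp add: field_simps)
    qed auto
    also have "\<dots> \<le> real (?M choose card A)"
      by (rule binomial_ge_n_over_k_pow_k) (use A in linarith)
    finally have "real (2 ^ (64 * m)) \<le> real (?M choose card A)" by simp
    then show ?thesis by linarith
  qed (use A(3) in simp)
  then have "card ?bad * 2 ^ (64 * m) \<le> 2 ^ (32 * m) * fact ?M"
    using 1 by (meson le_trans mult_le_mono2)
  moreover have "(2::nat) ^ (64 * m) = 2 ^ (32 * m) * 2 ^ (32 * m)"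
    by (simp add: power_add[symmetric])
  ultimately have "2 ^ (32 * m) * (card ?bad * 2 ^ (32 * m)) \<le> 2 ^ (32 * m) * fact ?M"
    by (simp add: ac_simps)
  then show ?thesis by simp
qed

text \<open>First moment method. For each \<open>A\<close> between the lower bound and half of
  \<open>V\<close>, the tuples of \<open>r\<close> permutations that all nearly preserve it have
  proportion at most \<open>2 ^ (- 32 * m * r)\<close>; there are at most
  \<open>2 ^ (2560 * m)\<close> such sets, and \<open>2560 < 32 * r\<close>.\<close>

lemma ex_expanding_permutations:
  fixes m r :: nat
  assumes "m > 0" and r: "2560 < 32 * r"
  defines "V \<equiv> {..<2560 * m}"
  shows "\<exists>\<pi>. (\<forall>i<r. \<pi> i permutes V) \<and>
    (\<forall>A\<subseteq>V. (\<forall>i<r. card (\<pi> i ` A - A) \<le> m) \<longrightarrow> card A < 64 * m \<or> 2560 * m < card A + 64 * m)"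
proof -
  let ?M = "2560 * m"
  have finV: "finite V" and cV: "card V = ?M" by (auto simp: V_def)
  define S where "S = {A. A \<subseteq> V \<and> 64 * m \<le> card A \<and> 2 * card A \<le> ?M}"
  define bad where "bad A = {\<pi>. \<pi> permutes V \<and> card (\<pi> ` A - A) \<le> m}" for A
  let ?I = "{..<r}"
  let ?T = "Pi\<^sub>E ?I (\<lambda>_. {\<pi>. \<pi> permutes V})"
  let ?U = "\<Union>A\<in>S. Pi\<^sub>E ?I (\<lambda>_. bad A)"
  have finbad: "finite (bad A)" for A
    unfolding bad_def by (rule finite_subset[OF _ finite_permutations[OF finV]]) auto
  have finS: "finite S" unfolding S_def using finV by simp
  have cS: "card S \<le> 2 ^ ?M"
  proof -
    have "card S \<le> card (Pow V)" by (rule card_mono) (use finV in \<open>auto simp: S_def\<close>)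
    then show ?thesis using finV cV by (simp add: card_Pow)
  qed
  have cT: "card ?T = fact ?M ^ r"
    by (simp only: card_PiE finite_lessThan card_permutations[OF cV finV] prod_constant card_lessThan)
  have "card ?U * 2 ^ (32 * m * r) \<le> (\<Sum>A\<in>S. card (Pi\<^sub>E ?I (\<lambda>_. bad A))) * 2 ^ (32 * m * r)"
    by (intro mult_le_mono1 card_UN_le finS)
  also have "\<dots> = (\<Sum>A\<in>S. (card (bad A) * 2 ^ (32 * m)) ^ r)"
    by (simp only: card_PiE sum_distrib_right power_mult_distrib power_mult
      finite_lessThan prod_constant card_lessThan)
  also have "\<dots> \<le> (\<Sum>A\<in>S. fact ?M ^ r)"
  proof (intro sum_mono power_mono)
    fix A assume "A \<in> S"
    then show "card (bad A) * 2 ^ (32 * m) \<le> fact ?M"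
      using card_nearly_invariant_permutes[of A m] unfolding S_def bad_def V_def by auto
  qed auto
  also have "\<dots> \<le> 2 ^ ?M * fact ?M ^ r"
    unfolding sum_constant of_nat_id using cS by (rule mult_le_mono1)
  also have "\<dots> < 2 ^ (32 * m * r) * fact ?M ^ r"
  proof (rule mult_strict_right_mono)
    show "(2::nat) ^ ?M < 2 ^ (32 * m * r)"
    proof (rule power_strict_increasing)
      have "m * 2560 < m * (32 * r)" using assms(1) r by (simp only: nat_mult_less_cancel1)
      then show "?M < 32 * m * r" by (simp only: ac_simps)
    qed simp
  qed (simp only: zero_less_power fact_gt_zero)
  finally have "card ?U * 2 ^ (32 * m * r) < card ?T * 2 ^ (32 * m * r)"
    unfolding cT by (simp only: mult.commute)
  then have "card ?U < card ?T" by (simp only: mult_less_cancel2)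
  moreover have "finite ?U" using finS finbad by (intro finite_UN_I finite_PiE) auto
  ultimately have "\<not> ?T \<subseteq> ?U" using card_mono by (metis leD)
  then obtain \<pi> where \<pi>: "\<pi> \<in> ?T" "\<pi> \<notin> ?U" by blast
  have perm: "\<pi> i permutes V" if "i < r" for i
    using \<pi>(1) that by (auto simp: PiE_def Pi_def)
  have key: False if A: "A \<subseteq> V" "\<forall>i<r. card (\<pi> i ` A - A) \<le> m" "64 * m \<le> card A"
      "2 * card A \<le> ?M" for A
  proof -
    have "\<pi> \<in> Pi\<^sub>E ?I (\<lambda>_. bad A)"
      using \<pi>(1) A(2) by (auto simp: PiE_def Pi_def bad_def)
    moreover have "A \<in> S" using A by (simp add: S_def)
    ultimately show False using \<pi>(2) by blast
  qed
  have "card A < 64 * m \<or> ?M < card A + 64 * m"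
    if A: "A \<subseteq> V" "\<forall>i<r. card (\<pi> i ` A - A) \<le> m" for A
  proof (rule ccontr)
    assume neg: "\<not> ?thesis"
    show False
    proof (cases "2 * card A \<le> ?M")
      case True
      then show False using key[OF A] neg by simp
    next
      \<comment> \<open>Sets larger than half are handled through the complement: a permutation
        moves as many points out of a finite set as into it.\<close>
      case False
      have finA: "finite A" using A(1) finV finite_subset by auto
      have cC: "card (V - A) = ?M - card A"
        using card_Diff_subset[OF finA A(1)] cV by simp
      have "card (\<pi> i ` (V - A) - (V - A)) \<le> m" if i: "i < r" for i
      proof -
        have inj: "inj (\<pi> i)" using perm[OF i] permutes_inj by blast
        have im: "\<pi> i ` V = V" using perm[OF i] permutes_image by blast
        have "\<pi> i ` (V - A) - (V - A) = A - \<pi> i ` A"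
          using inj im A(1) by (auto simp: image_set_diff)
        moreover have "card (A - \<pi> i ` A) = card (\<pi> i ` A - A)"
         proof -
          have "card (\<pi> i ` A) = card A" by (intro card_image inj_on_subset[OF inj]) simp
          then show ?thesis
            using card_le_sym_Diff[of A "\<pi> i ` A"] card_le_sym_Diff[of "\<pi> i ` A" A] finA by simp
        qed
        ultimately show ?thesis using A(2) i by simp
      qed
      moreover have "64 * m \<le> card (V - A)" "2 * card (V - A) \<le> ?M"
        using cC neg False by linarith+
      ultimately show False using key[of "V - A"] by blast
    qed
  qed
  then show ?thesis using perm by blast
qed

section \<open>An expanding extension\<close>

text \<open>On each of the \<open>K\<close> blocks of \<open>p\<close> consecutive values of
  \<open>y\<close>, the map \<open>\<phi>\<close> is a bijection onto the residues, as
  \<open>q\<close> is invertible modulo \<open>p\<close>. So the translation \<open>q * y\<close> is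
  uniformly distributed when \<open>y\<close> is.\<close>

lemma card_multiple_residues_ge:
  fixes q j :: int and p K :: nat
  assumes p: "prime p" and q: "0 < q" "q < int p" and B: "B \<subseteq> {0..<int p}"
  shows "K * card B \<le> card {y \<in> {..<K * p}. (j + q * int y) mod int p \<in> B}"
proof -
  have p0: "p > 0" using p prime_gt_0_nat by blast
  define \<phi> where "\<phi> y = (j + q * int y) mod int p" for y :: nat
  have cop: "coprime q (int p)"
  proof -
    have "\<not> int p dvd q" using q zdvd_not_zless by blast
    then show ?thesis
      using p prime_imp_coprime[of "int p" q] by (simp add: coprime_commute)
  qed
  have inj: "inj_on \<phi> {..<p}"
  proof (rule inj_onI)
    fix y y' assume y: "y \<in> {..<p}" "y' \<in> {..<p}" "\<phi> y = \<phi> y'"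
    have "[j + q * int y = j + q * int y'] (mod int p)" using y by (simp add: \<phi>_def cong_def)
    then have "[q * int y = q * int y'] (mod int p)" using cong_add_lcancel by blast
    then have "[int y = int y'] (mod int p)" using cong_mult_lcancel[OF cop] by blast
    then show "y = y'" using y by (simp add: cong_def)
  qed
  have "\<phi> ` {..<p} \<subseteq> {0..<int p}" using p0 by (auto simp: \<phi>_def)
  then have im: "\<phi> ` {..<p} = {0..<int p}"
    by (intro card_subset_eq) (auto simp: card_image[OF inj])
  have "B = \<phi> ` {y \<in> {..<p}. \<phi> y \<in> B}"
  proof (intro equalityI subsetI)
    fix b assume b: "b \<in> B"
    then have "b \<in> \<phi> ` {..<p}" using B im by auto
    then show "b \<in> \<phi> ` {y \<in> {..<p}. \<phi> y \<in> B}" using b by auto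
  qed auto
  then have cB: "card B \<le> card {y \<in> {..<p}. \<phi> y \<in> B}"
    using card_image_le[of "{y \<in> {..<p}. \<phi> y \<in> B}" \<phi>] by simp
  let ?f = "\<lambda>(k, y). k * p + y"
  have "K * card B \<le> card ({..<K} \<times> {y \<in> {..<p}. \<phi> y \<in> B})"
    using cB by simp
  also have "\<dots> \<le> card {y \<in> {..<K * p}. \<phi> y \<in> B}"
  proof (rule card_inj_on_le[of ?f])
    show "inj_on ?f ({..<K} \<times> {y \<in> {..<p}. \<phi> y \<in> B})"
    proof (rule inj_onI, clarsimp)
      fix k k' y y' assume *: "k * p + y = k' * p + y'" "y < p" "y' < p"
      have "(a * p + b) div p = a" if "b < p" for a b using that by simp
      from this[OF *(2), of k] this[OF *(3), of k'] have "k = k'" using *(1) by metis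
      then show "k = k' \<and> y = y'" using *(1) by simp
    qed
    show "?f ` ({..<K} \<times> {y \<in> {..<p}. \<phi> y \<in> B}) \<subseteq> {y \<in> {..<K * p}. \<phi> y \<in> B}"
    proof clarsimp
      fix k y assume *: "k < K" "y < p" "\<phi> y \<in> B"
      have "k * p + y < Suc k * p" using * by simp
      also have "\<dots> \<le> K * p" using * by (intro mult_le_mono1) simp
      finally have "k * p + y < K * p" .
      moreover have "\<phi> (k * p + y) = \<phi> y"
      proof -
        have "j + q * int (k * p + y) = (j + q * int y) + int p * (q * int k)"
          by (simp add: algebra_simps)
        then show ?thesis unfolding \<phi>_def by (simp only: mod_mult_self2)
      qed
      ultimately show "k * p + y < K * p \<and> \<phi> (k * p + y) \<in> B" using * by simp
    qed
  qed simp
  finally show ?thesis by (simp add: \<phi>_def)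
qed

text \<open>The permutations \<open>\<pi> i\<close> force almost every slice \<open>sl j\<close> to
  be nearly empty or nearly full, so \<open>A\<close> is close to \<open>J \<times> V\<close>. Under
  the skew shift a point of \<open>J\<close> goes to a uniformly distributed residue as
  \<open>y\<close> varies, so \<open>card J * (p - card J)\<close> must be small as well, and
  \<open>J\<close> itself is nearly empty or nearly everything.\<close>

lemma expander_extension:
  fixes p r :: nat and q :: int and A :: "(int \<times> nat) set"
  defines "V \<equiv> {..<2560 * p}" and "Z \<equiv> {0..<int p}"
  assumes p: "prime p" and q: "0 < q" "q < int p"
    and perm: "\<And>i. i < r \<Longrightarrow> \<pi> i permutes V"
    and exp: "\<And>B. B \<subseteq> V \<Longrightarrow> \<forall>i<r. card (\<pi> i ` B - B) \<le> p \<Longrightarrow>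
      card B < 64 * p \<or> 2560 * p < card B + 64 * p"
    and A: "A \<subseteq> Z \<times> V"
    and e1: "\<And>i. i < r \<Longrightarrow> 40 * r * card {(j, y) \<in> A. (j, \<pi> i y) \<notin> A} \<le> p * p"
    and e2: "40 * card {(j, y) \<in> A. ((j + q * int y) mod int p, y) \<notin> A} \<le> 2560 * p * p"
  shows "4 * card A \<le> 2560 * p * p \<or> 3 * (2560 * p * p) \<le> 4 * card A"
proof -
  have p0: "p > 0" using p prime_gt_0_nat by blast
  have fin: "finite V" "finite Z" and cV: "card V = 2560 * p" and cZ: "card Z = p"
    by (auto simp: V_def Z_def)
  define sl where "sl j = {y. (j, y) \<in> A}" for j
  have slV: "sl j \<subseteq> V" for j using A by (auto simp: sl_def)
  have finsl: "finite (sl j)" for j using slV fin finite_subset by blast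
  have csl: "card (sl j) \<le> 2560 * p" for j using card_mono[OF fin(1) slV] cV by simp
  define J where "J = {j \<in> Z. 2560 * p < 2 * card (sl j)}"
  define bad where "bad i = {j \<in> Z. p < card (\<pi> i ` sl j - sl j)}" for i
  define Bad where "Bad = (\<Union>i<r. bad i)"
  have finbad: "finite (bad i)" for i using fin by (simp add: bad_def)
  have BadZ: "Bad \<subseteq> Z" by (auto simp: Bad_def bad_def)
  have JZ: "J \<subseteq> Z" by (auto simp: J_def)
  have finJ: "finite J" using JZ fin finite_subset by blast
  have cb: "40 * r * card (bad i) \<le> p" if i: "i < r" for i
  proof -
    let ?E = "{(j, y) \<in> A. (j, \<pi> i y) \<notin> A}"
    have finE: "finite ?E"
      by (rule finite_subset[of _ "Z \<times> V"]) (use A fin in auto)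
    have inj: "inj (\<pi> i)" using perm[OF i] permutes_inj by blast
    have c: "p \<le> card {y \<in> sl j. \<pi> i y \<notin> sl j}" if "j \<in> bad i" for j
    proof -
      have "\<pi> i ` sl j - sl j = \<pi> i ` {y \<in> sl j. \<pi> i y \<notin> sl j}" by auto
      then have "card (\<pi> i ` sl j - sl j) = card {y \<in> sl j. \<pi> i y \<notin> sl j}"
        using card_image[OF inj_on_subset[OF inj]] by (metis subset_UNIV)
      then show ?thesis using that by (simp add: bad_def)
    qed
    have "card (bad i) * p = (\<Sum>j\<in>bad i. p)" by simp
    also have "\<dots> \<le> (\<Sum>j\<in>bad i. card {y \<in> sl j. \<pi> i y \<notin> sl j})"
      by (rule sum_mono) (rule c)
    also have "\<dots> = card (SIGMA j:bad i. {y \<in> sl j. \<pi> i y \<notin> sl j})"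
      using finbad finsl by simp
    also have "\<dots> \<le> card ?E"
      by (rule card_mono[OF finE]) (auto simp: sl_def)
    finally have "40 * r * (card (bad i) * p) \<le> 40 * r * card ?E" by (rule mult_le_mono2)
    also have "\<dots> \<le> p * p" by (rule e1[OF i])
    finally have "(40 * r * card (bad i)) * p \<le> p * p" by (simp only: mult.assoc)
    then show ?thesis using p0 by simp
  qed
  have cBad: "40 * card Bad \<le> p"
  proof (cases "r = 0")
    case False
    have "r * (40 * card Bad) \<le> r * (40 * (\<Sum>i<r. card (bad i)))"
      unfolding Bad_def by (intro mult_le_mono2 card_UN_le) simp
    also have "\<dots> = (\<Sum>i<r. 40 * r * card (bad i))" by (simp only: sum_distrib_left mult.assoc mult.left_commute)
    also have "\<dots> \<le> (\<Sum>i<r. p)" by (rule sum_mono) (use cb in auto)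
    finally show ?thesis using False by simp
  qed (simp add: Bad_def)
  \<comment> \<open>The symmetric difference of \<open>A\<close> and \<open>J \<times> V\<close>. A
    good slice contributes at most 1/40 of \<open>V\<close>; the bad slices, at most 1/40 of all,
    may contribute everything. This gives 1/20 of \<open>Z \<times> V\<close>.\<close>
  define \<Delta> where "\<Delta> = (SIGMA j:Z. {y \<in> V. (y \<in> sl j) \<noteq> (j \<in> J)})"
  have fin\<Delta>: "finite \<Delta>" using fin by (simp add: \<Delta>_def)
  have sd: "card {y \<in> V. (y \<in> sl j) \<noteq> (j \<in> J)} \<le> 64 * p + (if j \<in> Bad then 2560 * p else 0)"
    if j: "j \<in> Z" for j
  proof (cases "j \<in> Bad")
    case True
    have "card {y \<in> V. (y \<in> sl j) \<noteq> (j \<in> J)} \<le> card V" by (rule card_mono) (use fin in auto)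
    then show ?thesis using True cV by simp
  next
    case False
    then have "\<forall>i<r. card (\<pi> i ` sl j - sl j) \<le> p"
      using j by (auto simp: Bad_def bad_def not_less)
    from exp[OF slV this] have *: "card (sl j) < 64 * p \<or> 2560 * p < card (sl j) + 64 * p" .
    show ?thesis
    proof (cases "j \<in> J")
      case True
      then have eq: "{y \<in> V. (y \<in> sl j) \<noteq> (j \<in> J)} = V - sl j" by auto
      have "card (V - sl j) = 2560 * p - card (sl j)"
        using card_Diff_subset[OF finsl slV] cV by simp
      then show ?thesis using eq * True by (simp add: J_def)
    next
      case False
      then have "{y \<in> V. (y \<in> sl j) \<noteq> (j \<in> J)} = sl j" using slV by auto
      then show ?thesis using * False j by (simp add: J_def)
    qed
  qed
  have c\<Delta>: "20 * card \<Delta> \<le> 2560 * p * p"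
  proof -
    have "card \<Delta> = (\<Sum>j\<in>Z. card {y \<in> V. (y \<in> sl j) \<noteq> (j \<in> J)})"
      unfolding \<Delta>_def using fin by simp
    also have "\<dots> \<le> (\<Sum>j\<in>Z. 64 * p + (if j \<in> Bad then 2560 * p else 0))"
      by (rule sum_mono) (rule sd)
    also have "\<dots> = 64 * p * p + 2560 * p * card (Z \<inter> Bad)"
      using fin cZ by (simp add: sum.distrib sum.If_cases)
    also have "Z \<inter> Bad = Bad" using BadZ by auto
    finally have "20 * card \<Delta> \<le> 1280 * p * p + 1280 * p * (40 * card Bad)" by simp
    also have "1280 * p * (40 * card Bad) \<le> 1280 * p * p" using cBad by (rule mult_le_mono2)
    finally show ?thesis by simp
  qed
  let ?s = "\<lambda>(j, y). ((j + q * int y) mod int p, y)"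
  let ?Es = "{(j, y) \<in> A. ((j + q * int y) mod int p, y) \<notin> A}"
  have finEs: "finite ?Es"
    by (rule finite_subset[of _ "Z \<times> V"]) (use A fin in auto)
  let ?P = "{x \<in> Z \<times> V. ?s x \<in> \<Delta>}"
  have finP: "finite ?P" using fin by simp
  have cP: "card ?P \<le> card \<Delta>"
  proof (rule card_inj_on_le[of ?s])
    show "inj_on ?s ?P"
    proof (rule inj_onI, clarsimp)
      fix j j' y assume *: "j \<in> Z" "j' \<in> Z" "(j + q * int y) mod int p = (j' + q * int y) mod int p"
      then have "[j + q * int y = j' + q * int y] (mod int p)" by (simp add: cong_def)
      then have "[j = j'] (mod int p)" using cong_add_rcancel by blast
      then show "j = j'" using * by (simp add: cong_def Z_def)
    qed
  qed (use fin\<Delta> in auto)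
  have cX: "2560 * (p - card J) * card J \<le> card (SIGMA j:J. {y \<in> V. (j + q * int y) mod int p \<in> Z - J})"
  proof -
    have "2560 * (p - card J) * card J = (\<Sum>j\<in>J. 2560 * card (Z - J))"
      using card_Diff_subset[OF finJ JZ] cZ by simp
    also have "\<dots> \<le> (\<Sum>j\<in>J. card {y \<in> V. (j + q * int y) mod int p \<in> Z - J})"
      unfolding V_def
      by (intro sum_mono card_multiple_residues_ge p q) (auto simp: Z_def)
    also have "\<dots> = card (SIGMA j:J. {y \<in> V. (j + q * int y) mod int p \<in> Z - J})"
      using fin finJ by simp
    finally show ?thesis .
  qed
  \<comment> \<open>A point over \<open>J\<close> that is moved out of \<open>J\<close> is missing
    from \<open>A\<close>, or leaves \<open>A\<close>, or lands in \<open>A\<close> over the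
    complement of \<open>J\<close>. The first and the last case lie in \<open>\<Delta>\<close> and
    in its preimage, so the total is at most 1/20 + 1/40 + 1/20 = 1/8.\<close>
  have "(SIGMA j:J. {y \<in> V. (j + q * int y) mod int p \<in> Z - J}) \<subseteq> \<Delta> \<union> ?Es \<union> ?P"
    using JZ by (auto simp: \<Delta>_def sl_def)
  then have "card (SIGMA j:J. {y \<in> V. (j + q * int y) mod int p \<in> Z - J}) \<le> card (\<Delta> \<union> ?Es \<union> ?P)"
    by (intro card_mono) (use fin\<Delta> finEs finP in auto)
  also have "\<dots> \<le> card \<Delta> + card ?Es + card ?P"
    using card_Un_le[of "\<Delta> \<union> ?Es" ?P] card_Un_le[of \<Delta> ?Es] by linarith
  finally have "40 * (2560 * (p - card J) * card J) \<le> 40 * card \<Delta> + 40 * card ?Es + 40 * card \<Delta>"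
    using cX cP by linarith
  also have "\<dots> \<le> 5 * (2560 * p * p)" using c\<Delta> e2 by linarith
  finally have key: "8 * ((p - card J) * card J) \<le> p * p" by (simp add: ac_simps)
  have cJ: "card J \<le> p" using card_mono[OF fin(2) JZ] cZ by simp
  have "A \<subseteq> J \<times> V \<union> \<Delta>" using A by (auto simp: \<Delta>_def sl_def)
  then have "card A \<le> card (J \<times> V \<union> \<Delta>)" by (intro card_mono) (use finJ fin fin\<Delta> in auto)
  also have "\<dots> \<le> card J * (2560 * p) + card \<Delta>" using card_Un_le[of "J \<times> V" \<Delta>] unfolding card_cartesian_product cV .
  finally have u: "card A \<le> card J * (2560 * p) + card \<Delta>" .
  have finA: "finite A" using A fin finite_subset by blast
  have "J \<times> V \<subseteq> A \<union> \<Delta>" using JZ by (auto simp: \<Delta>_def sl_def)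
  then have "card (J \<times> V) \<le> card (A \<union> \<Delta>)" by (intro card_mono) (use finA fin\<Delta> in auto)
  then have l: "card J * (2560 * p) \<le> card A + card \<Delta>"
    using card_Un_le[of A \<Delta>] unfolding card_cartesian_product cV by (rule le_trans)
  \<comment> \<open>Strictly between 1/5 and 4/5 the quadratic \<open>t * (1 - t)\<close> exceeds
    4/25, hence 1/8. Adding the 1/20 of \<open>\<Delta>\<close> to 1/5 yields the final 1/4.\<close>
  have "5 * card J \<le> p \<or> 4 * p \<le> 5 * card J"
  proof (rule ccontr)
    assume "\<not> ?thesis"
    then have "0 < (5 * real (card J) - real p) * (4 * real p - 5 * real (card J))"
      by (intro mult_pos_pos) linarith+
    moreover have "8 * ((real p - real (card J)) * real (card J)) \<le> real p * real p"
    proof -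
      have "real (8 * ((p - card J) * card J)) \<le> real (p * p)"
        using key by (simp only: of_nat_le_iff)
      then show ?thesis using cJ by (simp add: of_nat_diff)
    qed
    ultimately have "25 * real (card J) * real p - 25 * real (card J) * real (card J) - 4 * (real p * real p) > 0"
      "8 * (real (card J) * real p) - 8 * (real (card J) * real (card J)) \<le> real p * real p"
      by (simp_all add: algebra_simps)
    moreover have "0 < real p * real p" using p0 by simp
    ultimately show False by (simp add: algebra_simps)
  qed
  then show ?thesis
  proof
    assume "5 * card J \<le> p"
    then have "(5 * card J) * (2560 * p) \<le> p * (2560 * p)" by (rule mult_le_mono1)
    then have "5 * (card J * (2560 * p)) \<le> 2560 * p * p" by (simp only: ac_simps)
    then show ?thesis using u c\<Delta> by linarith
  next
    assume "4 * p \<le> 5 * card J"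
    then have "(4 * p) * (2560 * p) \<le> (5 * card J) * (2560 * p)" by (rule mult_le_mono1)
    then have "4 * (2560 * p * p) \<le> 5 * (card J * (2560 * p))" by (simp only: ac_simps)
    then show ?thesis using l c\<Delta> by linarith
  qed
qed

section \<open>The almost commuting generators, and why no true action is near them\<close>

type_synonym point = "int \<times> nat \<times> bool \<times> int \<times> int"

text \<open>
  A point \<open>(j, y, z, u, q)\<close> consists of \<open>j \<in> \<int>/p\<close>, a vertex \<open>y\<close> of the expander, the bit \<open>z\<close>,
  the inert coordinate \<open>u \<in> \<int>/p\<close> moved by the true action only, and the scalar \<open>q\<close>.
\<close>

definition points :: "nat \<Rightarrow> point set" where
  "points p = {0..<int p} \<times> {..<2560 * p} \<times> UNIV \<times> {0..<int p} \<times> {1..<int p}"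

text \<open>Generators up to \<open>r\<close> commute exactly with \<open>shift_f\<close>; the last
  one, an involution, fails to do so only at the two ends of the interval
  \<open>j < p div 2\<close>.\<close>

fun gen :: "(nat \<Rightarrow> nat \<Rightarrow> nat) \<Rightarrow> nat \<Rightarrow> nat \<Rightarrow> nat \<Rightarrow> point \<Rightarrow> point" where
  "gen \<pi> r p i (j, y, z, u, q) =
    (if i < r then (j, \<pi> i y, z, u, q)
     else if i = r then ((j + q * int y) mod int p, y, z, u, q)
     else (j, y, z \<noteq> (j < int (p div 2)), u, q))"

fun shift_f :: "nat \<Rightarrow> point \<Rightarrow> point" where
  "shift_f p (j, y, z, u, q) = ((j + 1) mod int p, y, z, u, q)"

lemma shift_f_pow:
  assumes "p > 0" "j \<in> {0..<int p}"
  shows "(shift_f p ^^ k) (j, y, z, u, q) = ((j + int k) mod int p, y, z, u, q)"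
  using assms by (induction k) (auto simp: mod_simps ac_simps)

lemma finite_points: "finite (points p)"
  by (simp add: points_def)

text \<open>Averaging over \<open>(u, q)\<close>. Both coordinates are constant under
  \<open>shift_f\<close> and \<open>gen\<close>, and \<open>expander_extension\<close> concerns one
  fixed \<open>q\<close>, so the argument is run on a single slice with few errors.\<close>

lemma ex_small_slice:
  fixes p r :: nat and E :: "point set"
  assumes p: "p > 1" and E: "E \<subseteq> points p" "a * card E \<le> card (points p)"
  shows "\<exists>u\<in>{0..<int p}. \<exists>q\<in>{1..<int p}.
    a * card {(j, y, z). (j, y, z, u, q) \<in> E} \<le> 5120 * p * p"
proof (rule ccontr)
  assume neg: "\<not> ?thesis"
  let ?I = "{0..<int p} \<times> {1..<int p}"
  let ?sl = "\<lambda>(u, q). {(j, y, z). (j, y, z, u, q) \<in> E}"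
  have fin: "finite (?sl w)" for w
    by (rule finite_subset[of _ "{0..<int p} \<times> {..<2560 * p} \<times> UNIV"])
      (use E(1) in \<open>auto simp: points_def split: prod.splits\<close>)
  have ne: "?I \<noteq> {}" using p by simp
  have "card (points p) = card ?I * (5120 * p * p)"
    by (simp add: points_def card_cartesian_product)
  also have "\<dots> = (\<Sum>w\<in>?I. 5120 * p * p)" by simp
  also have "\<dots> < (\<Sum>w\<in>?I. a * card (?sl w))"
    by (rule sum_strict_mono) (use ne neg in \<open>auto simp: not_le\<close>)
  also have "\<dots> = a * card (SIGMA w:?I. ?sl w)"
    using fin by (simp add: sum_distrib_left)
  also have "card (SIGMA w:?I. ?sl w) \<le> card E"
    by (rule card_inj_on_le[of "\<lambda>((u, q), j, y, z). (j, y, z, u, q)"])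
      (auto simp: inj_on_def intro: finite_subset[OF E(1) finite_points])
  finally show False using E(2) by simp
qed

text \<open>Here \<open>\<tau>\<close> and \<open>H\<close> stand for the full twist and the
  conjugated generators in a true action, \<open>\<psi>\<close> for the inclusion of the given
  points. Only subsets of \<open>points p\<close> are counted, so the size of the larger set never
  enters; this is why unboundedly many added points do not help.\<close>

lemma no_nearby_commuting_extension:
  fixes \<psi> :: "point \<Rightarrow> 'b" and p r :: nat
  assumes p: "prime p" "odd p" and r: "r > 0"
    and perm: "\<And>i. i < r \<Longrightarrow> \<pi> i permutes {..<2560 * p}"
    and exp: "\<And>B. B \<subseteq> {..<2560 * p} \<Longrightarrow> \<forall>i<r. card (\<pi> i ` B - B) \<le> p \<Longrightarrow>
      card B < 64 * p \<or> 2560 * p < card B + 64 * p"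
    and inj: "inj_on \<psi> (points p)"
    and comm: "\<And>i x. i \<le> Suc r \<Longrightarrow> \<tau> (H i x) = H i (\<tau> x)"
    and E: "1000000 * r * card {x \<in> points p. \<tau> (\<psi> x) \<noteq> \<psi> (shift_f p x) \<or>
      (\<exists>i\<le>Suc r. H i (\<psi> x) \<noteq> \<psi> (gen \<pi> r p i x))} \<le> card (points p)"
  shows False
proof -
  define err where "err = {x \<in> points p. \<tau> (\<psi> x) \<noteq> \<psi> (shift_f p x) \<or>
      (\<exists>i\<le>Suc r. H i (\<psi> x) \<noteq> \<psi> (gen \<pi> r p i x))}"
  have p3: "p \<ge> 3" using p prime_ge_2_nat[OF p(1)] by (cases "p = 2") auto
  then have p0: "p > 0" by simp
  obtain u q where u: "u \<in> {0..<int p}" and q: "q \<in> {1..<int p}"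
    and small: "1000000 * r * card {(j, y, z). (j, y, z, u, q) \<in> err} \<le> 5120 * p * p"
    using ex_small_slice[of p err "1000000 * r"] E p3 unfolding err_def by auto
  define N where "N = {(j, y, z). (j, y, z, u, q) \<in> err}"
  define Z where "Z = {0..<int p}"
  define V where "V = {..<2560 * p}"
  have finZV: "finite (Z \<times> V)" by (simp add: Z_def V_def)
  have cZV: "card (Z \<times> V) = 2560 * p * p" by (simp add: Z_def V_def)
  have NZV: "N \<subseteq> {(j, y, z). (j, y) \<in> Z \<times> V}"
    by (auto simp: N_def err_def points_def Z_def V_def)
  have finN: "finite N"
    by (rule finite_subset[of _ "Z \<times> V \<times> UNIV"]) (use NZV in \<open>auto simp: Z_def V_def\<close>)
  have cN: "1000000 * r * card N \<le> 5120 * p * p" using small by (simp add: N_def)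
  have cN': "80 * r * card N \<le> p * p"
  proof -
    have "12500 * (80 * r * card N) \<le> 12500 * (p * p)" using cN by simp
    then show ?thesis by (simp only: mult_le_cancel1)
  qed
  have cN1: "80 * card N \<le> p * p"
  proof -
    have "1 * (80 * card N) \<le> r * (80 * card N)" by (rule mult_le_mono1) (use r in simp)
    also have "\<dots> = 80 * r * card N" by (simp only: ac_simps)
    finally show ?thesis using cN' by linarith
  qed
  define sh where "sh k = (\<lambda>(j, y::nat). ((j + int k) mod int p, y))" for k :: nat
  have sh_inj: "inj_on (sh k) (Z \<times> V)" for k
  proof (rule inj_onI, clarsimp simp: sh_def)
    fix j j' y assume *: "j \<in> Z" "j' \<in> Z" "(j + int k) mod int p = (j' + int k) mod int p"
    then have "[j + int k = j' + int k] (mod int p)" by (simp add: cong_def)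
    then have "[j = j'] (mod int p)" using cong_add_rcancel by blast
    then show "j = j'" using * by (simp add: cong_def Z_def)
  qed
  define Nz where "Nz z = {(j, y). (j, y, z) \<in> N}" for z
  have NzZV: "Nz z \<subseteq> Z \<times> V" for z using NZV by (auto simp: Nz_def)
  have finNz: "finite (Nz z)" for z using NzZV finZV finite_subset by blast
  have cNz: "card (Nz z) \<le> card N" for z
    by (rule card_inj_on_le[of "\<lambda>(j, y). (j, y, z)"]) (use finN in \<open>auto simp: inj_on_def Nz_def\<close>)
  have cNsh: "card {x \<in> Z \<times> V. sh k x \<in> Nz z} \<le> card N" for k z
  proof -
    have "card {x \<in> Z \<times> V. sh k x \<in> Nz z} \<le> card (Nz z)"
      by (rule card_inj_on_le[of "sh k"]) (use sh_inj finNz in \<open>auto intro: inj_on_subset\<close>)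
    then show ?thesis using cNz[of z] by simp
  qed
  define pt where "pt z = (\<lambda>(j::int, y::nat). (j, y, z::bool, u, q))" for z
  have ptP: "pt z x \<in> points p" if "x \<in> Z \<times> V" for z x
    using that u q by (auto simp: pt_def points_def Z_def V_def)
  have shZV: "sh k x \<in> Z \<times> V" if "x \<in> Z \<times> V" for k x
    using that p0 by (auto simp: sh_def Z_def)
  have errI: "pt z x \<in> err \<longleftrightarrow> x \<in> Nz z" for z x
    by (cases x) (auto simp: pt_def Nz_def N_def)
  have pow: "(shift_f p ^^ k) (pt z x) = pt z (sh k x)" if "x \<in> Z \<times> V" for k z x
    using that shift_f_pow[OF p0] by (cases x) (auto simp: pt_def sh_def Z_def)
  have goodt: "\<tau> (\<psi> (pt z x)) = \<psi> (pt z (sh 1 x))" if "x \<in> Z \<times> V" "x \<notin> Nz z" for z x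
  proof -
    have "pt z x \<notin> err" using that errI by blast
    then have "\<tau> (\<psi> (pt z x)) = \<psi> (shift_f p (pt z x))" using ptP[OF that(1)] by (auto simp: err_def)
    then show ?thesis using pow[OF that(1), of 1] by simp
  qed
  have goodg: "H i (\<psi> (pt z x)) = \<psi> (gen \<pi> r p i (pt z x))"
    if "x \<in> Z \<times> V" "x \<notin> Nz z" "i \<le> Suc r" for z x i
    using that ptP[OF that(1), of z] errI[of z x] by (auto simp: err_def)
  have tauH: "(\<tau> ^^ k) (H i x) = H i ((\<tau> ^^ k) x)" if "i \<le> Suc r" for i k x
    by (induction k) (simp_all add: comm[OF that])
  \<comment> \<open>The set where the \<open>k\<close>-th powers agree, in the slice with bit
    \<open>z\<close>. By exact commutation, membership passes from \<open>x\<close> to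
    \<open>g i x\<close> unless \<open>x\<close> or \<open>sh k x\<close> is an error point, so the
    defect \<open>2 * card N\<close> does not depend on \<open>k\<close>.\<close>
  define A where "A k z = {x \<in> Z \<times> V. (\<tau> ^^ k) (\<psi> (pt z x)) = \<psi> (pt z (sh k x))}" for k z
  have AZV: "A k z \<subseteq> Z \<times> V" for k z by (auto simp: A_def)
  have finA: "finite (A k z)" for k z using AZV finZV finite_subset by blast
  define g where "g i = (\<lambda>(j, y). if i < r then (j, \<pi> i y) else ((j + q * int y) mod int p, y))" for i
  have gZV: "g i x \<in> Z \<times> V" if "x \<in> Z \<times> V" for i x
    using that p0 perm[of i] permutes_in_image[OF perm] by (auto simp: g_def Z_def V_def)
  have gpt: "gen \<pi> r p i (pt z x) = pt z (g i x)" if "i \<le> r" for i z x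
    using that by (cases x) (auto simp: g_def pt_def)
  have gsh: "g i (sh k x) = sh k (g i x)" for i k x
    by (cases x) (auto simp: g_def sh_def mod_simps ac_simps)
  have inv: "card {x \<in> A k z. g i x \<notin> A k z} \<le> 2 * card N" if i: "i \<le> r" for i k z
  proof -
    have "{x \<in> A k z. g i x \<notin> A k z} \<subseteq> Nz z \<union> {x \<in> Z \<times> V. sh k x \<in> Nz z}"
    proof (rule ccontr)
      assume "\<not> ?thesis"
      then obtain x where x: "x \<in> A k z" "g i x \<notin> A k z" "x \<notin> Nz z" "sh k x \<notin> Nz z"
        using AZV by blast
      have xZ: "x \<in> Z \<times> V" using x AZV by blast
      have i': "i \<le> Suc r" using i by simp
      have "(\<tau> ^^ k) (\<psi> (pt z (g i x))) = (\<tau> ^^ k) (H i (\<psi> (pt z x)))"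
        using goodg[OF xZ x(3) i'] gpt[OF i] by simp
      also have "\<dots> = H i (\<psi> (pt z (sh k x)))" using tauH[OF i'] x(1) by (simp add: A_def)
      also have "\<dots> = \<psi> (pt z (sh k (g i x)))"
        using goodg[OF shZV[OF xZ] x(4) i'] gpt[OF i] gsh by simp
      finally have "g i x \<in> A k z" using gZV[OF xZ] by (simp add: A_def)
      then show False using x by blast
    qed
    then have "card {x \<in> A k z. g i x \<notin> A k z} \<le> card (Nz z \<union> {x \<in> Z \<times> V. sh k x \<in> Nz z})"
      by (intro card_mono) (use finNz finZV in auto)
    then show ?thesis
      using card_Un_le[of "Nz z" "{x \<in> Z \<times> V. sh k x \<in> Nz z}"] cNz[of z] cNsh[of k z] by linarith
  qed
  have dich: "4 * card (A k z) \<le> 2560 * p * p \<or> 3 * (2560 * p * p) \<le> 4 * card (A k z)" for k z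
  proof (rule expander_extension[OF p(1), of q r \<pi>])
    show "A k z \<subseteq> {0..<int p} \<times> {..<2560 * p}" using AZV by (simp add: Z_def V_def)
    show "40 * r * card {(j, y) \<in> A k z. (j, \<pi> i y) \<notin> A k z} \<le> p * p" if i: "i < r" for i
    proof -
      have "{(j, y) \<in> A k z. (j, \<pi> i y) \<notin> A k z} = {x \<in> A k z. g i x \<notin> A k z}"
        using i by (auto simp: g_def)
      then have "card {(j, y) \<in> A k z. (j, \<pi> i y) \<notin> A k z} \<le> 2 * card N" using inv[of i k z] i by simp
      then have "40 * r * card {(j, y) \<in> A k z. (j, \<pi> i y) \<notin> A k z} \<le> 40 * r * (2 * card N)"
        by (rule mult_le_mono2)
      also have "\<dots> = 80 * r * card N" by simp
      finally show ?thesis using cN' by linarith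
    qed
    have "{(j, y) \<in> A k z. ((j + q * int y) mod int p, y) \<notin> A k z} = {x \<in> A k z. g r x \<notin> A k z}"
      by (auto simp: g_def)
    then show "40 * card {(j, y) \<in> A k z. ((j + q * int y) mod int p, y) \<notin> A k z} \<le> 2560 * p * p"
      using inv[of r k z] cN1 by simp
  qed (use q perm exp in auto)
  \<comment> \<open>One more power loses at most \<open>card N\<close> points, too few to fall from
    3/4 to 1/4. The dichotomy therefore restores the bound 3/4 at every step, and errors do not
    accumulate.\<close>
  have large: "3 * (2560 * p * p) \<le> 4 * card (A k z)" for k z
  proof (induction k)
    case 0
    have "A 0 z = Z \<times> V" by (auto simp: A_def sh_def Z_def)
    then show ?case using cZV by simp
  next
    case (Suc k)
    have "A k z \<subseteq> A (Suc k) z \<union> {x \<in> Z \<times> V. sh k x \<in> Nz z}"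
    proof
      fix x assume x: "x \<in> A k z"
      then have xZ: "x \<in> Z \<times> V" using AZV by blast
      have "sh 1 (sh k x) = sh (Suc k) x" by (cases x) (auto simp: sh_def mod_simps ac_simps)
      then have "x \<in> A (Suc k) z" if "sh k x \<notin> Nz z"
        using goodt[OF shZV[OF xZ] that] x xZ by (auto simp: A_def)
      then show "x \<in> A (Suc k) z \<union> {x \<in> Z \<times> V. sh k x \<in> Nz z}" using xZ by blast
    qed
    then have "card (A k z) \<le> card (A (Suc k) z \<union> {x \<in> Z \<times> V. sh k x \<in> Nz z})"
      by (intro card_mono) (use finA finZV in auto)
    also have "\<dots> \<le> card (A (Suc k) z) + card N"
      using card_Un_le[of "A (Suc k) z" "{x \<in> Z \<times> V. sh k x \<in> Nz z}"] cNsh[of k z] by linarith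
    finally have "card (A k z) \<le> card (A (Suc k) z) + card N" .
    moreover have "0 < p * p" using p0 by simp
    ultimately have "\<not> 4 * card (A (Suc k) z) \<le> 2560 * p * p" using Suc cN1 by linarith
    then show ?case using dich by blast
  qed
  \<comment> \<open>As \<open>p = 2 * h + 1\<close>, translation by \<open>h\<close> moves every
    residue except \<open>j = h\<close> across the boundary of \<open>j < h\<close>.\<close>
  define h where "h = p div 2"
  have ph: "p = 2 * h + 1" using p(2) by (simp add: h_def)
  define \<zeta> where "\<zeta> x = (fst x < int h)" for x :: "int \<times> nat"
  have cpt: "gen \<pi> r p (Suc r) (pt False x) = pt (\<zeta> x) x" for x
    by (cases x) (auto simp: pt_def \<zeta>_def h_def)
  have half: "\<zeta> (sh h x) \<noteq> \<zeta> x" if "x \<in> Z \<times> V" "fst x \<noteq> int h" for x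
  proof (cases x)
    case (Pair j y)
    show ?thesis
    proof (cases "j < int h")
      case True
      then have "(j + int h) mod int p = j + int h" using that Pair ph by (auto simp: Z_def)
      then show ?thesis using True that Pair by (simp add: \<zeta>_def sh_def Z_def)
    next
      case False
      have "(j + int h) mod int p = (j + int h - int p) mod int p" by simp
      also have "\<dots> = j + int h - int p"
        using False that Pair ph by (intro mod_pos_pos_trivial) (auto simp: Z_def)
      finally show ?thesis using False that Pair ph by (auto simp: \<zeta>_def sh_def Z_def)
    qed
  qed
  \<comment> \<open>Outside these five sets, commutation of \<open>\<tau> ^^ h\<close> with
    \<open>H (Suc r)\<close> would force the bits \<open>\<zeta> x\<close> and
    \<open>\<zeta> (sh h x)\<close> to be equal. The two complements of \<open>A\<close> take at
    most 1/4 each and the other three sets are small, so they cannot cover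
    \<open>Z \<times> V\<close>. Both bits are needed because the last generator may turn
    \<open>False\<close> into \<open>True\<close>.\<close>
  have "Z \<times> V \<subseteq> {int h} \<times> V \<union> (Z \<times> V - A h True) \<union> (Z \<times> V - A h False) \<union> Nz False
     \<union> {x \<in> Z \<times> V. sh h x \<in> Nz False}" (is "_ \<subseteq> ?U1 \<union> ?U2 \<union> ?U3 \<union> ?U4 \<union> ?U5")
  proof (rule ccontr)
    assume "\<not> ?thesis"
    then obtain x where xZ: "x \<in> Z \<times> V" and nx: "x \<notin> ?U1 \<union> ?U2 \<union> ?U3 \<union> ?U4 \<union> ?U5"
      by blast
    have x: "fst x \<noteq> int h" "x \<in> A h True" "x \<in> A h False" "x \<notin> Nz False" "sh h x \<notin> Nz False"
      using nx xZ by (simp_all add: mem_Times_iff)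
    have "\<psi> (pt (\<zeta> x) (sh h x)) = (\<tau> ^^ h) (\<psi> (pt (\<zeta> x) x))"
      using x(2,3) by (cases "\<zeta> x") (auto simp: A_def)
    also have "\<dots> = (\<tau> ^^ h) (H (Suc r) (\<psi> (pt False x)))"
      using goodg[OF xZ x(4)] cpt by simp
    also have "\<dots> = H (Suc r) (\<psi> (pt False (sh h x)))" using tauH x(3) by (simp add: A_def)
    also have "\<dots> = \<psi> (pt (\<zeta> (sh h x)) (sh h x))"
      using goodg[OF shZV[OF xZ] x(5)] cpt by simp
    finally have "pt (\<zeta> x) (sh h x) = pt (\<zeta> (sh h x)) (sh h x)"
      by (rule inj_onD[OF inj]) (rule ptP[OF shZV[OF xZ]])+
    then have "\<zeta> x = \<zeta> (sh h x)" by (auto simp: pt_def split: prod.splits)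
    then show False using half[OF xZ x(1)] by simp
  qed
  then have "card (Z \<times> V) \<le> card (?U1 \<union> ?U2 \<union> ?U3 \<union> ?U4 \<union> ?U5)"
    by (intro card_mono) (use finZV finNz in \<open>auto simp: V_def\<close>)
  also have "\<dots> \<le> card ?U1 + card ?U2 + card ?U3 + card ?U4 + card ?U5"
    by (meson card_Un_le add_le_mono le_refl le_trans)
  also have "card ?U1 = 2560 * p" by (simp add: V_def)
  also have "card ?U4 \<le> card N" by (rule cNz)
  also have "card ?U5 \<le> card N" by (rule cNsh)
  finally have "4 * card (Z \<times> V) \<le> 4 * (2560 * p) + 4 * card ?U2 + 4 * card ?U3 + 8 * card N" by simp
  moreover have "4 * card (Z \<times> V - A h z) \<le> 2560 * p * p" for z
    using large[of h z] card_Diff_subset[OF finA AZV, of h z] cZV by simp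
  from this[of True] this[of False]
  have "4 * card ?U2 + 4 * card ?U3 \<le> 2 * (2560 * p * p)" by linarith
  ultimately have "20 * (2560 * p * p) \<le> 40 * (2560 * p) + p * p" using cZV cN1 by linarith
  moreover have "3 * p \<le> p * p" using p3 by simp
  ultimately show False using p0 by simp
qed

section \<open>Asymptotically almost all points\<close>

definition asymp_all :: "(nat \<Rightarrow> 'x set) \<Rightarrow> (nat \<Rightarrow> 'x \<Rightarrow> bool) \<Rightarrow> bool" where
  "asymp_all X P \<longleftrightarrow> (\<lambda>l. real (card {x \<in> X l. \<not> P l x}) / real (card (X l))) \<longlonglongrightarrow> 0"

lemma asymp_all_dominated:
  assumes lim: "g \<longlonglongrightarrow> (0::real)"
    and le: "\<And>l. real (card {x \<in> X l. \<not> P l x}) / real (card (X l)) \<le> g l"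
  shows "asymp_all X P"
  unfolding asymp_all_def
  by (rule tendsto_sandwich[OF _ _ tendsto_const lim]) (use le in auto)

lemma asymp_all_mono:
  assumes "\<And>l. finite (X l)" "asymp_all X P" "\<And>l x. x \<in> X l \<Longrightarrow> P l x \<Longrightarrow> Q l x"
  shows "asymp_all X Q"
proof (rule asymp_all_dominated[OF assms(2)[unfolded asymp_all_def]])
  fix l
  show "real (card {x \<in> X l. \<not> Q l x}) / real (card (X l)) \<le> real (card {x \<in> X l. \<not> P l x}) / real (card (X l))"
    by (intro divide_right_mono of_nat_mono card_mono) (use assms in auto)
qed

lemma asymp_all_conj:
  assumes "\<And>l. finite (X l)" "asymp_all X P" "asymp_all X Q"
  shows "asymp_all X (\<lambda>l x. P l x \<and> Q l x)"
proof (rule asymp_all_dominated)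
  show "(\<lambda>l. real (card {x \<in> X l. \<not> P l x}) / real (card (X l)) +
      real (card {x \<in> X l. \<not> Q l x}) / real (card (X l))) \<longlonglongrightarrow> 0"
    using tendsto_add[OF assms(2,3)[unfolded asymp_all_def]] by simp
  fix l
  have "{x \<in> X l. \<not> (P l x \<and> Q l x)} = {x \<in> X l. \<not> P l x} \<union> {x \<in> X l. \<not> Q l x}" by auto
  then have "card {x \<in> X l. \<not> (P l x \<and> Q l x)} \<le> card {x \<in> X l. \<not> P l x} + card {x \<in> X l. \<not> Q l x}"
    using card_Un_le by metis
  then have "real (card {x \<in> X l. \<not> (P l x \<and> Q l x)}) / real (card (X l)) \<le>
     (real (card {x \<in> X l. \<not> P l x}) + real (card {x \<in> X l. \<not> Q l x})) / real (card (X l))"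
    by (intro divide_right_mono) auto
  then show "real (card {x \<in> X l. \<not> (P l x \<and> Q l x)}) / real (card (X l)) \<le>
      real (card {x \<in> X l. \<not> P l x}) / real (card (X l)) +
      real (card {x \<in> X l. \<not> Q l x}) / real (card (X l))"
    by (simp add: add_divide_distrib)
qed

lemma asymp_all_mono2:
  assumes "\<And>l. finite (X l)" "asymp_all X P" "asymp_all X Q" "\<And>l x. x \<in> X l \<Longrightarrow> P l x \<Longrightarrow> Q l x \<Longrightarrow> R l x"
  shows "asymp_all X R"
  using asymp_all_mono[OF assms(1) asymp_all_conj[OF assms(1-3)], of R] assms(4) by auto

lemma asymp_all_always: "(\<And>l x. x \<in> X l \<Longrightarrow> P l x) \<Longrightarrow> asymp_all X P"
  by (rule asymp_all_dominated[OF tendsto_const]) (auto intro!: order.refl simp: card_eq_0_iff divide_le_0_iff)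

lemma asymp_all_ball:
  assumes "finite S" "\<And>l. finite (X l)" "\<And>s. s \<in> S \<Longrightarrow> asymp_all X (P s)"
  shows "asymp_all X (\<lambda>l x. \<forall>s\<in>S. P s l x)"
  using assms(1,3)
proof (induction S)
  case empty
  show ?case by (rule asymp_all_always) auto
next
  case (insert s S)
  show ?case
    by (rule asymp_all_mono2[OF assms(2) insert.prems[of s] insert.IH]) (use insert.prems in auto)
qed

lemma asymp_all_pullback:
  assumes "\<And>l. finite (X l)" "asymp_all X P"
    and "\<And>l. inj_on (\<phi> l) (X l)" "\<And>l x. x \<in> X l \<Longrightarrow> \<phi> l x \<in> X l"
  shows "asymp_all X (\<lambda>l x. P l (\<phi> l x))"
proof (rule asymp_all_dominated[OF assms(2)[unfolded asymp_all_def]])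
  fix l
  have "card {x \<in> X l. \<not> P l (\<phi> l x)} \<le> card {x \<in> X l. \<not> P l x}"
    by (rule card_inj_on_le[of "\<phi> l"]) (use assms in \<open>auto intro: inj_on_subset\<close>)
  then show "real (card {x \<in> X l. \<not> P l (\<phi> l x)}) / real (card (X l)) \<le> real (card {x \<in> X l. \<not> P l x}) / real (card (X l))"
    by (intro divide_right_mono) auto
qed

text \<open>\<open>S\<close> does not vary with \<open>l\<close>, so restricting to one block costs
  only the constant factor \<open>card S\<close>.\<close>

lemma asymp_all_slice:
  assumes "finite S" "\<And>l. finite (X l)" "asymp_all (\<lambda>l. S \<times> X l) P" "s \<in> S"
  shows "asymp_all X (\<lambda>l x. P l (s, x))"
proof (rule asymp_all_dominated)
  show "(\<lambda>l. real (card S) * (real (card {x \<in> S \<times> X l. \<not> P l x}) / real (card (S \<times> X l)))) \<longlonglongrightarrow> 0"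
    using tendsto_mult_right_zero[OF assms(3)[unfolded asymp_all_def]] .
  fix l
  have S: "real (card S) > 0" using assms(1,4) by (auto simp: card_gt_0_iff)
  have "card {x \<in> X l. \<not> P l (s, x)} \<le> card {x \<in> S \<times> X l. \<not> P l x}"
    by (rule card_inj_on_le[of "Pair s"]) (use assms in \<open>auto simp: inj_on_def\<close>)
  then have "real (card {x \<in> X l. \<not> P l (s, x)}) / real (card (X l))
     \<le> real (card {x \<in> S \<times> X l. \<not> P l x}) / real (card (X l))"
    by (intro divide_right_mono) auto
  also have "\<dots> = real (card S) * (real (card {x \<in> S \<times> X l. \<not> P l x}) / real (card (S \<times> X l)))"
    using S by (simp add: card_cartesian_product)
  finally show "real (card {x \<in> X l. \<not> P l (s, x)}) / real (card (X l)) \<le>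
    real (card S) * (real (card {x \<in> S \<times> X l. \<not> P l x}) / real (card (S \<times> X l)))" .
qed

lemma asymp_all_Times:
  assumes "finite S" "\<And>l. finite (X l)" "\<And>s. s \<in> S \<Longrightarrow> asymp_all X (\<lambda>l x. P l (s, x))"
  shows "asymp_all (\<lambda>l. S \<times> X l) P"
proof (rule asymp_all_dominated)
  have all: "asymp_all X (\<lambda>l x. \<forall>s\<in>S. P l (s, x))" using asymp_all_ball[OF assms] .
  show "(\<lambda>l. real (card {x \<in> X l. \<not> (\<forall>s\<in>S. P l (s, x))}) / real (card (X l))) \<longlonglongrightarrow> 0"
    using all unfolding asymp_all_def .
  fix l
  let ?B = "{x \<in> X l. \<not> (\<forall>s\<in>S. P l (s, x))}"
  show "real (card {x \<in> S \<times> X l. \<not> P l x}) / real (card (S \<times> X l)) \<le> real (card ?B) / real (card (X l))"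
  proof (cases "S = {}")
    case False
    then have S: "real (card S) > 0" using assms(1) by (auto simp: card_gt_0_iff)
    have "card {x \<in> S \<times> X l. \<not> P l x} \<le> card (S \<times> ?B)"
      by (rule card_mono) (use assms in auto)
    then have "real (card {x \<in> S \<times> X l. \<not> P l x}) / real (card (S \<times> X l)) \<le> real (card (S \<times> ?B)) / real (card (S \<times> X l))"
      by (intro divide_right_mono) auto
    also have "\<dots> = real (card ?B) / real (card (X l))"
      using S by (simp add: card_cartesian_product)
    finally show ?thesis .
  qed simp
qed

lemma asymp_all_eventually:
  assumes "asymp_all X P" "\<And>l. finite (X l)" "\<And>l. X l \<noteq> {}"
  shows "\<forall>\<^sub>F l in sequentially. c * card {x \<in> X l. \<not> P l x} \<le> card (X l)"
proof -
  have "\<forall>\<^sub>F l in sequentially. real (card {x \<in> X l. \<not> P l x}) / real (card (X l)) < 1 / (real c + 1)"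
    using assms(1) unfolding asymp_all_def by (rule order_tendstoD) simp
  then show ?thesis
  proof (rule eventually_mono)
    fix l assume l: "real (card {x \<in> X l. \<not> P l x}) / real (card (X l)) < 1 / (real c + 1)"
    have "real (card (X l)) > 0" using assms(2,3) by (simp add: card_gt_0_iff)
    then have "real (card {x \<in> X l. \<not> P l x}) * (real c + 1) < real (card (X l))"
      using l by (simp add: field_simps)
    then have "real (c * card {x \<in> X l. \<not> P l x}) \<le> real (card (X l))"
      by (simp add: algebra_simps)
    then show "c * card {x \<in> X l. \<not> P l x} \<le> card (X l)" by (simp only: of_nat_le_iff)
  qed
qed

text \<open>The coupling inequality: both maps are evaluated at the same uniform point, and points
  where they agree contribute equally to both distributions.\<close>

lemma tv_dist_map_pmf_le:
  assumes "finite S" "S \<noteq> {}" "finite A"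
  shows "tv_dist A (map_pmf a (pmf_of_set S)) (map_pmf b (pmf_of_set S))
    \<le> real (card {x \<in> S. a x \<noteq> b x}) / real (card S)"
proof -
  let ?N = "real (card S)"
  let ?D = "{x \<in> S. a x \<noteq> b x}"
  have N: "?N > 0" using assms by (simp add: card_gt_0_iff)
  have pm: "pmf (map_pmf c (pmf_of_set S)) s = real (card {x \<in> S. c x = s}) / ?N" for c :: "'a \<Rightarrow> 'b" and s
  proof -
    have "pmf (map_pmf c (pmf_of_set S)) s = measure_pmf.prob (pmf_of_set S) (c -` {s})"
      by (rule pmf_map)
    also have "\<dots> = real (card (S \<inter> c -` {s})) / ?N"
      by (rule measure_pmf_of_set) (use assms in auto)
    also have "S \<inter> c -` {s} = {x \<in> S. c x = s}" by auto
    finally show ?thesis .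
  qed
  have split: "card {x \<in> S. c x = s} = card {x \<in> S. a x = b x \<and> c x = s} + card {x \<in> ?D. c x = s}"
    for c :: "'a \<Rightarrow> 'b" and s
  proof -
    have "{x \<in> S. c x = s} = {x \<in> S. a x = b x \<and> c x = s} \<union> {x \<in> ?D. c x = s}" by auto
    then show ?thesis using assms(1) by (simp add: card_Un_disjoint[symmetric] disjoint_iff)
  qed
  have diff: "\<bar>pmf (map_pmf a (pmf_of_set S)) s - pmf (map_pmf b (pmf_of_set S)) s\<bar>
     \<le> (real (card {x \<in> ?D. a x = s}) + real (card {x \<in> ?D. b x = s})) / ?N" for s
  proof -
    have "{x \<in> S. a x = b x \<and> a x = s} = {x \<in> S. a x = b x \<and> b x = s}" by auto
    then have "real (card {x \<in> S. a x = s}) - real (card {x \<in> S. b x = s})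
       = real (card {x \<in> ?D. a x = s}) - real (card {x \<in> ?D. b x = s})"
      using split[of a s] split[of b s] by simp
    then have "\<bar>real (card {x \<in> S. a x = s}) - real (card {x \<in> S. b x = s})\<bar>
       \<le> real (card {x \<in> ?D. a x = s}) + real (card {x \<in> ?D. b x = s})" by linarith
    then have "\<bar>real (card {x \<in> S. a x = s}) - real (card {x \<in> S. b x = s})\<bar> / ?N
       \<le> (real (card {x \<in> ?D. a x = s}) + real (card {x \<in> ?D. b x = s})) / ?N"
      by (intro divide_right_mono) auto
    then show ?thesis unfolding pm using N by (simp add: diff_divide_distrib[symmetric])
  qed
  have tot: "(\<Sum>s\<in>A. card {x \<in> ?D. c x = s}) \<le> card ?D" for c :: "'a \<Rightarrow> 'b"
  proof -
    have "(\<Sum>s\<in>A. card {x \<in> ?D. c x = s}) = card (\<Union>s\<in>A. {x \<in> ?D. c x = s})"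
      by (rule card_UN_disjoint[symmetric]) (use assms in auto)
    also have "\<dots> \<le> card ?D" by (rule card_mono) (use assms in auto)
    finally show ?thesis .
  qed
  have tot': "(\<Sum>s\<in>A. real (card {x \<in> ?D. c x = s})) \<le> real (card ?D)" for c :: "'a \<Rightarrow> 'b"
    using tot[of c] by (simp only: of_nat_sum[symmetric] of_nat_le_iff)
  have "(\<Sum>s\<in>A. \<bar>pmf (map_pmf a (pmf_of_set S)) s - pmf (map_pmf b (pmf_of_set S)) s\<bar>)
    \<le> (\<Sum>s\<in>A. (real (card {x \<in> ?D. a x = s}) + real (card {x \<in> ?D. b x = s})) / ?N)"
    by (rule sum_mono) (rule diff)
  also have "\<dots> = ((\<Sum>s\<in>A. real (card {x \<in> ?D. a x = s})) + (\<Sum>s\<in>A. real (card {x \<in> ?D. b x = s}))) / ?N"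
    by (simp add: sum_divide_distrib[symmetric] sum.distrib)
  also have "\<dots> \<le> (real (card ?D) + real (card ?D)) / ?N"
    by (intro divide_right_mono add_mono tot') simp
  finally show ?thesis unfolding tv_dist_def by (simp add: mult.commute)
qed

section \<open>Words in signed letters, and the braid relations\<close>

definition eval_word :: "('a \<Rightarrow> 'x \<Rightarrow> 'x) \<Rightarrow> 'a list \<Rightarrow> 'x \<Rightarrow> 'x" where
  "eval_word L w = foldr (\<lambda>a. (\<circ>) (L a)) w id"

lemma eval_word_Nil [simp]: "eval_word L [] x = x"
  and eval_word_Cons [simp]: "eval_word L (a # w) x = L a (eval_word L w x)"
  and eval_word_append [simp]: "eval_word L (u @ v) x = eval_word L u (eval_word L v x)"
proof -
  show "eval_word L [] x = x" "eval_word L (a # w) x = L a (eval_word L w x)" for a w x by (simp_all add: eval_word_def)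
  then show "eval_word L (u @ v) x = eval_word L u (eval_word L v x)" by (induction u) simp_all
qed

lemma eval_word_closed:
  assumes "w \<in> lists D" "x \<in> X" "\<And>a x. a \<in> D \<Longrightarrow> x \<in> X \<Longrightarrow> L a x \<in> X"
  shows "eval_word L w x \<in> X"
  using assms(1) by (induction w) (use assms(2,3) in auto)

lemma eval_word_inj_on:
  assumes "w \<in> lists D" "\<And>a x. a \<in> D \<Longrightarrow> x \<in> X \<Longrightarrow> L a x \<in> X" "\<And>a. a \<in> D \<Longrightarrow> inj_on (L a) X"
  shows "inj_on (eval_word L w) X"
  using assms(1)
proof (induction w)
  case Nil
  then show ?case by (simp add: inj_on_def)
next
  case (Cons a w)
  have "eval_word L w ` X \<subseteq> X" using eval_word_closed[of w D _ X L] Cons.hyps assms(2) by blast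
  then have "inj_on (L a) (eval_word L w ` X)" using assms(3)[OF Cons.hyps(1)] inj_on_subset by blast
  then have "inj_on (L a \<circ> eval_word L w) X" using Cons.IH comp_inj_on by blast
  then show ?case by (simp add: comp_def inj_on_def)
qed

text \<open>Shared by two actions: the Artin letters on marked strands, and the letters
  \<open>A\<close>, \<open>B\<close>, \<open>T\<close> on the fibre over one state. Inverses are
  exact even for an almost action, so every word acts by a bijection.\<close>

locale signed_letters =
  fixes D :: "'a set" and X :: "nat \<Rightarrow> 'x set" and L :: "nat \<Rightarrow> 'a \<times> bool \<Rightarrow> 'x \<Rightarrow> 'x"
  assumes fin: "finite (X l)"
    and L_closed: "i \<in> D \<Longrightarrow> x \<in> X l \<Longrightarrow> L l (i, b) x \<in> X l"
    and L_cancel: "i \<in> D \<Longrightarrow> x \<in> X l \<Longrightarrow> L l (i, \<not> b) (L l (i, b) x) = x"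
begin

lemma eval_word_in: "w \<in> lists (D \<times> UNIV) \<Longrightarrow> x \<in> X l \<Longrightarrow> eval_word (L l) w x \<in> X l"
  by (rule eval_word_closed) (auto intro: L_closed)

lemma inj_eval_word: "w \<in> lists (D \<times> UNIV) \<Longrightarrow> inj_on (eval_word (L l) w) (X l)"
proof (rule eval_word_inj_on)
  fix a assume "a \<in> D \<times> (UNIV :: bool set)"
  then show "inj_on (L l a) (X l)"
    by (cases a) (auto intro!: inj_on_inverseI[where g = "L l (fst a, \<not> snd a)"] L_cancel)
qed (auto intro: L_closed)

lemma bij_eval_word: "w \<in> lists (D \<times> UNIV) \<Longrightarrow> bij_betw (eval_word (L l) w) (X l) (X l)"
  using inj_eval_word[of w l] eval_word_in[of w] endo_inj_surj[OF fin]
  by (metis bij_betw_def image_subsetI)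

lemma asymp_all_eval_word:
  assumes "w \<in> lists (D \<times> UNIV)" "asymp_all X P"
  shows "asymp_all X (\<lambda>l x. P l (eval_word (L l) w x))"
  by (rule asymp_all_pullback[OF fin assms(2)]) (use inj_eval_word eval_word_in assms(1) in auto)

end

locale almost_braid_action = signed_letters "{1..<n}" X F for n :: nat and X :: "nat \<Rightarrow> 'x set" and F +
  assumes L_commute: "i \<in> {1..<n} \<Longrightarrow> j \<in> {1..<n} \<Longrightarrow> i + 2 \<le> j \<Longrightarrow>
      asymp_all X (\<lambda>l x. F l (i, True) (F l (j, True) x) = F l (j, True) (F l (i, True) x))"
    and L_braid: "i \<in> {1..<n} \<Longrightarrow> i + 1 \<in> {1..<n} \<Longrightarrow>
      asymp_all X (\<lambda>l x. F l (i, True) (F l (i + 1, True) (F l (i, True) x)) =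
        F l (i + 1, True) (F l (i, True) (F l (i + 1, True) x)))"
begin

text \<open>Induction over the derivation. In a product the exceptional set of the left factor is
  pulled back along the action of the right factor, an injective map, so its proportion does not
  grow.\<close>

lemma braid_eq_asymp_all: "braid_eq n u v \<Longrightarrow> asymp_all X (\<lambda>l x. eval_word (F l) u x = eval_word (F l) v x)"
proof (induction rule: braid_eq.induct)
  case (refl w)
  show ?case by (rule asymp_all_always) simp
next
  case (sym u v)
  show ?case by (rule asymp_all_mono[OF fin sym.IH]) simp
next
  case (trans u v w)
  show ?case by (rule asymp_all_mono2[OF fin trans.IH]) simp
next
  case (append u u' v v')
  have v: "v \<in> lists ({1..<n} \<times> UNIV)"
    using braid_eq_words[OF append.hyps(2)] by (simp add: braid_words_def)
  show ?case
    by (rule asymp_all_mono2[OF fin asymp_all_eval_word[OF v append.IH(1)] append.IH(2)]) simp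
next
  case (cancel i b)
  show ?case by (rule asymp_all_always) (use cancel L_cancel[of i _ _ "\<not> b"] in simp)
next
  case (commute i j)
  show ?case using L_commute[OF commute] by simp
next
  case (braid i)
  show ?case using L_braid[OF braid] by simp
qed

end

locale braid_action = signed_letters "{1..<n}" X G for n :: nat and X :: "nat \<Rightarrow> 'x set" and G +
  assumes L_commute: "i \<in> {1..<n} \<Longrightarrow> j \<in> {1..<n} \<Longrightarrow> i + 2 \<le> j \<Longrightarrow> x \<in> X l \<Longrightarrow>
      G l (i, True) (G l (j, True) x) = G l (j, True) (G l (i, True) x)"
    and L_braid: "i \<in> {1..<n} \<Longrightarrow> i + 1 \<in> {1..<n} \<Longrightarrow> x \<in> X l \<Longrightarrow>
      G l (i, True) (G l (i + 1, True) (G l (i, True) x)) =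
        G l (i + 1, True) (G l (i, True) (G l (i + 1, True) x))"
begin

lemma braid_eq_eval_word: "braid_eq n u v \<Longrightarrow> x \<in> X l \<Longrightarrow> eval_word (G l) u x = eval_word (G l) v x"
proof (induction arbitrary: x rule: braid_eq.induct)
  case (append u u' v v')
  have v: "v' \<in> lists ({1..<n} \<times> UNIV)"
    using braid_eq_words[OF append.hyps(2)] by (simp add: braid_words_def)
  show ?case using append eval_word_in[OF v] by simp
next
  case (cancel i b)
  then show ?case using L_cancel[of i _ _ "\<not> b"] by simp
next
  case (commute i j)
  then show ?case using L_commute[of i j x l] by simp
next
  case (braid i)
  then show ?case using L_braid[of i x l] by simp
qed auto

end

section \<open>Nearby actions of a rigid braid group\<close>

text \<open>The extension by the identity outside the image of \<open>\<beta>\<close> is what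
  \<open>permutes\<close> demands.\<close>

definition transport :: "'x set \<Rightarrow> ('x \<Rightarrow> nat) \<Rightarrow> ('x \<Rightarrow> 'x) \<Rightarrow> nat \<Rightarrow> nat" where
  "transport X \<beta> \<phi> k = (if k \<in> \<beta> ` X then \<beta> (\<phi> (inv_into X \<beta> k)) else k)"

lemma transport_apply: "inj_on \<beta> X \<Longrightarrow> x \<in> X \<Longrightarrow> transport X \<beta> \<phi> (\<beta> x) = \<beta> (\<phi> x)"
  by (simp add: transport_def inv_into_f_f)

lemma transport_permutes:
  assumes "bij_betw \<beta> X Y" "bij_betw \<phi> X X"
  shows "transport X \<beta> \<phi> permutes Y"
proof (rule bij_imp_permutes)
  have Y: "\<beta> ` X = Y" using assms(1) by (simp add: bij_betw_def)
  have "bij_betw (\<beta> \<circ> \<phi> \<circ> inv_into X \<beta>) Y Y"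
    by (rule bij_betw_trans[OF bij_betw_inv_into[OF assms(1)] bij_betw_trans[OF assms(2,1)]])
  then show "bij_betw (transport X \<beta> \<phi>) Y Y"
    by (rule bij_betw_cong[THEN iffD1, rotated]) (simp add: transport_def Y)
  show "transport X \<beta> \<phi> x = x" if "x \<notin> Y" for x using that by (simp add: transport_def Y)
qed

lemma card_bij_Collect:
  assumes "bij_betw \<beta> X Y"
  shows "card {k \<in> Y. P k} = card {x \<in> X. P (\<beta> x)}"
proof -
  have "{k \<in> Y. P k} = \<beta> ` {x \<in> X. P (\<beta> x)}" using assms by (auto simp: bij_betw_def)
  moreover have "inj_on \<beta> {x \<in> X. P (\<beta> x)}"
    using assms by (auto simp: bij_betw_def intro: inj_on_subset)
  ultimately show ?thesis by (simp add: card_image)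
qed

lemma perm_dist_bij:
  assumes "bij_betw \<beta> X {1..m}"
  shows "perm_dist m \<sigma> \<tau> = real (card {x \<in> X. \<not> \<sigma> (\<beta> x) = \<tau> (\<beta> x)}) / real (card X)"
  using card_bij_Collect[OF assms, of "\<lambda>k. \<sigma> k \<noteq> \<tau> k"] bij_betw_same_card[OF assms]
  by (simp add: perm_dist_def)

text \<open>An almost action assigns a map to a word, not to a braid. A chosen word makes it a
  function on the group, and another choice changes that function only on an asymptotically
  negligible set.\<close>

definition rep :: "'a set \<Rightarrow> 'a" where "rep \<gamma> = (SOME w. w \<in> \<gamma>)"

lemma rep_class:
  assumes "w \<in> braid_words n"
  shows "rep (braid_rel n `` {w}) \<in> braid_words n" "braid_eq n (rep (braid_rel n `` {w})) w"
proof -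
  have "w \<in> braid_rel n `` {w}" using assms by (simp add: braid_rel_def braid_eq.refl)
  then have "rep (braid_rel n `` {w}) \<in> braid_rel n `` {w}" unfolding rep_def by (rule someI)
  then have "braid_eq n w (rep (braid_rel n `` {w}))" by (simp add: braid_rel_def)
  then show eq: "braid_eq n (rep (braid_rel n `` {w})) w" by (rule braid_eq.sym)
  then show "rep (braid_rel n `` {w}) \<in> braid_words n" by (simp add: braid_eq_words)
qed

text \<open>Turns rigidity, stated for permutations of initial segments, into a statement about
  actions on arbitrary finite sets \<open>X l\<close>, with a conclusion about every word rather
  than chosen representatives. The pure braid group has the multiplication of the braid group on a
  smaller carrier, so both are treated at once.\<close>

lemma rigid_imp_nearby_hom:
  fixes X :: "nat \<Rightarrow> 'x set"
  assumes K: "K = braid_group n \<or> K = pure_braid_group n"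
    and F: "almost_braid_action n X F" and G: "braid_action n X G"
    and ne: "\<And>l. X l \<noteq> {}" and lim: "filterlim (\<lambda>l. card (X l)) at_top sequentially"
    and fix_eq: "\<And>w. w \<in> braid_words n \<Longrightarrow>
      asymp_all X (\<lambda>l x. (eval_word (F l) w x = x) = (eval_word (G l) w x = x))"
    and rigid: "UB_flexibly_BS_rigid K"
  obtains \<beta> :: "nat \<Rightarrow> 'x \<Rightarrow> nat" and N h where "\<And>l. inj_on (\<beta> l) (X l)"
    "\<And>l. h l \<in> hom K (sym_group (N l))"
    "\<And>w. w \<in> braid_words n \<Longrightarrow> braid_rel n `` {w} \<in> carrier K \<Longrightarrow>
      asymp_all X (\<lambda>l x. h l (braid_rel n `` {w}) (\<beta> l x) = \<beta> l (eval_word (F l) w x))"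
proof -
  interpret F: almost_braid_action n X F by (rule F)
  interpret G: braid_action n X G by (rule G)
  have grp: "group K" using K group_braid_group group_pure_braid_group by auto
  have Kc: "carrier K \<subseteq> carrier (braid_group n)" and Km: "mult K = mult (braid_group n)"
    using K by (auto simp: pure_braid_group_def kernel_def)
  have ex: "\<exists>\<beta>. bij_betw \<beta> (X l) {1..card (X l)}" for l
    using ex_bij_betw_nat_finite_1[OF F.fin] bij_betw_inv_into by blast
  define \<beta> where "\<beta> l = (SOME \<beta>. bij_betw \<beta> (X l) {1..card (X l)})" for l
  have \<beta>: "bij_betw (\<beta> l) (X l) {1..card (X l)}" for l
    unfolding \<beta>_def by (rule someI_ex[OF ex])
  have inj: "inj_on (\<beta> l) (X l)" for l using \<beta>[of l] by (simp add: bij_betw_def)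
  have wl: "w \<in> braid_words n \<longleftrightarrow> w \<in> lists ({1..<n} \<times> UNIV)" for w by (simp add: braid_words_def)
  define m where "m l = card (X l)" for l
  have bm: "bij_betw (\<beta> l) (X l) {1..m l}" for l using \<beta> by (simp add: m_def)
  define tr where "tr act l \<gamma> = transport (X l) (\<beta> l) (eval_word (act l) (rep \<gamma>))"
    for act :: "nat \<Rightarrow> nat \<times> bool \<Rightarrow> 'x \<Rightarrow> 'x" and l \<gamma>
  have tr: "tr act l \<gamma> (\<beta> l x) = \<beta> l (eval_word (act l) (rep \<gamma>) x)" if "x \<in> X l" for act l \<gamma> x
    unfolding tr_def using transport_apply[OF inj that] .
  have repw: "rep \<gamma> \<in> braid_words n" if "\<gamma> \<in> carrier K" for \<gamma>
  proof -
    have "\<gamma> \<in> carrier (braid_group n)" using that Kc by (rule rev_subsetD)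
    then obtain w where "w \<in> braid_words n" "\<gamma> = braid_rel n `` {w}"
      by (rule braid_group_carrierE)
    then show ?thesis using rep_class(1) by simp
  qed
  have repl: "rep \<gamma> \<in> lists ({1..<n} \<times> UNIV)" if "\<gamma> \<in> carrier K" for \<gamma>
    using repw[OF that] by (simp only: wl)
  have rep_mult: "braid_eq n (rep (\<gamma> \<otimes>\<^bsub>K\<^esub> \<delta>)) (rep \<gamma> @ rep \<delta>)"
    if \<gamma>: "\<gamma> \<in> carrier K" and \<delta>: "\<delta> \<in> carrier K" for \<gamma> \<delta>
  proof -
    have "\<gamma> \<in> carrier (braid_group n)" using \<gamma> Kc by (rule rev_subsetD)
    then obtain u where u: "u \<in> braid_words n" "\<gamma> = braid_rel n `` {u}"
      by (rule braid_group_carrierE)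
    have "\<delta> \<in> carrier (braid_group n)" using \<delta> Kc by (rule rev_subsetD)
    then obtain v where v: "v \<in> braid_words n" "\<delta> = braid_rel n `` {v}"
      by (rule braid_group_carrierE)
    have uv: "u @ v \<in> braid_words n" using u v by (simp add: braid_words_def)
    have "\<gamma> \<otimes>\<^bsub>K\<^esub> \<delta> = braid_rel n `` {u @ v}"
      using braid_group_mult u v Km by simp
    then have "braid_eq n (rep (\<gamma> \<otimes>\<^bsub>K\<^esub> \<delta>)) (u @ v)" using rep_class(2)[OF uv] by simp
    moreover have "braid_eq n (u @ v) (rep \<gamma> @ rep \<delta>)"
      using braid_eq.append[OF rep_class(2)[OF u(1)] rep_class(2)[OF v(1)]] u v
      by (simp add: braid_eq.sym)
    ultimately show ?thesis by (rule braid_eq.trans)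
  qed
  have trF: "tr F l \<gamma> permutes {1..m l}" and trG: "tr G l \<gamma> permutes {1..m l}"
    if "\<gamma> \<in> carrier K" for l \<gamma>
    unfolding tr_def
    by (intro transport_permutes[OF bm] F.bij_eval_word G.bij_eval_word repl[OF that])+
  have almost: "almost_hom_seq K m (tr F)"
    unfolding almost_hom_seq_def
  proof (intro conjI allI ballI)
    show "1 \<le> m l" for l using ne F.fin by (simp add: m_def Suc_le_eq card_gt_0_iff)
    show "filterlim m at_top sequentially" using lim unfolding m_def[abs_def] .
    show "tr F l \<in> carrier K \<rightarrow> carrier (sym_group (m l))" for l
      by (intro Pi_I) (simp only: sym_group_carrier trF)
    fix \<gamma> \<delta> assume \<gamma>: "\<gamma> \<in> carrier K" and \<delta>: "\<delta> \<in> carrier K"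
    have "asymp_all X (\<lambda>l x. tr F l (\<gamma> \<otimes>\<^bsub>K\<^esub> \<delta>) (\<beta> l x) = (tr F l \<gamma> \<circ> tr F l \<delta>) (\<beta> l x))"
      by (rule asymp_all_mono[OF F.fin F.braid_eq_asymp_all[OF rep_mult[OF \<gamma> \<delta>]]])
        (simp add: tr F.eval_word_in[OF repl[OF \<delta>]])
    then show "(\<lambda>l. perm_dist (m l) (tr F l (\<gamma> \<otimes>\<^bsub>K\<^esub> \<delta>)) (tr F l \<gamma> \<circ> tr F l \<delta>)) \<longlonglongrightarrow> 0"
      unfolding asymp_all_def perm_dist_bij[OF bm] .
  qed
  have homG: "tr G l \<in> hom K (sym_group (m l))" for l
  proof (rule homI)
    fix \<gamma> \<delta> assume \<gamma>: "\<gamma> \<in> carrier K" and \<delta>: "\<delta> \<in> carrier K"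
    show "tr G l \<gamma> \<in> carrier (sym_group (m l))" using trG[OF \<gamma>] by (simp only: sym_group_carrier)
    have KK: "\<gamma> \<otimes>\<^bsub>K\<^esub> \<delta> \<in> carrier K"
      by (rule monoid.m_closed[OF group.is_monoid[OF grp] \<gamma> \<delta>])
    have "tr G l (\<gamma> \<otimes>\<^bsub>K\<^esub> \<delta>) k = tr G l \<gamma> (tr G l \<delta> k)" for k
    proof (cases "k \<in> {1..m l}")
      case True
      then have "k \<in> \<beta> l ` X l" using bm[of l] by (simp add: bij_betw_def)
      then obtain x where x: "x \<in> X l" "k = \<beta> l x" by blast
      then show ?thesis
        using G.braid_eq_eval_word[OF rep_mult[OF \<gamma> \<delta>] x(1)] G.eval_word_in[OF repl[OF \<delta>] x(1)]
        by (simp add: tr)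
    next
      case False
      have "tr G l \<eta> k = k" if "\<eta> \<in> carrier K" for \<eta>
        using permutes_not_in[OF trG[OF that] False] .
      then show ?thesis using \<gamma> \<delta> KK by simp
    qed
    then show "tr G l (\<gamma> \<otimes>\<^bsub>K\<^esub> \<delta>) = tr G l \<gamma> \<otimes>\<^bsub>sym_group (m l)\<^esub> tr G l \<delta>"
      by (simp add: sym_group_mult fun_eq_iff)
  qed
  have tv: "(\<lambda>l. tv_dist (Pow Q) (stab_pmf (m l) (tr F l) Q) (stab_pmf (m l) (tr G l) Q)) \<longlonglongrightarrow> 0"
    if Q: "finite Q" "Q \<subseteq> carrier K" for Q
  proof -
    \<comment> \<open>As \<open>Q\<close> is finite, the two stabilizers agree on all of
      \<open>Q\<close> at almost every point; the coupling inequality then bounds the distance of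
      the statistics.\<close>
    have "asymp_all X (\<lambda>l x. \<forall>\<gamma>\<in>Q. (eval_word (F l) (rep \<gamma>) x = x) = (eval_word (G l) (rep \<gamma>) x = x))"
      by (rule asymp_all_ball[OF Q(1) F.fin], rule fix_eq, rule repw, rule subsetD[OF Q(2)])
    then have "asymp_all X (\<lambda>l x. {\<gamma> \<in> Q. tr F l \<gamma> (\<beta> l x) = \<beta> l x} = {\<gamma> \<in> Q. tr G l \<gamma> (\<beta> l x) = \<beta> l x})"
    proof (rule asymp_all_mono[OF F.fin])
      fix l x assume x: "x \<in> X l"
        and eq: "\<forall>\<gamma>\<in>Q. (eval_word (F l) (rep \<gamma>) x = x) = (eval_word (G l) (rep \<gamma>) x = x)"
      have "tr F l \<gamma> (\<beta> l x) = \<beta> l x \<longleftrightarrow> tr G l \<gamma> (\<beta> l x) = \<beta> l x" if \<gamma>: "\<gamma> \<in> Q" for \<gamma>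
      proof -
        have "rep \<gamma> \<in> lists ({1..<n} \<times> UNIV)" using repl \<gamma> Q(2) by blast
        then show ?thesis
          using bspec[OF eq \<gamma>] inj_on_eq_iff[OF inj F.eval_word_in[OF _ x] x]
            inj_on_eq_iff[OF inj G.eval_word_in[OF _ x] x] by (simp only: tr[OF x])
      qed
      then show "{\<gamma> \<in> Q. tr F l \<gamma> (\<beta> l x) = \<beta> l x} = {\<gamma> \<in> Q. tr G l \<gamma> (\<beta> l x) = \<beta> l x}"
        by blast
    qed
    then have lim0: "(\<lambda>l. real (card {k \<in> {1..m l}. {\<gamma> \<in> Q. tr F l \<gamma> k = k} \<noteq> {\<gamma> \<in> Q. tr G l \<gamma> k = k}}) / real (m l)) \<longlonglongrightarrow> 0"
      unfolding asymp_all_def card_bij_Collect[OF bm] by (simp add: m_def)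
    show ?thesis
    proof (rule tendsto_sandwich[OF _ _ tendsto_const lim0])
      show "\<forall>\<^sub>F l in sequentially. 0 \<le> tv_dist (Pow Q) (stab_pmf (m l) (tr F l) Q) (stab_pmf (m l) (tr G l) Q)"
        by (simp add: tv_dist_def sum_nonneg)
      have "tv_dist (Pow Q) (stab_pmf (m l) (tr F l) Q) (stab_pmf (m l) (tr G l) Q)
        \<le> real (card {k \<in> {1..m l}. {\<gamma> \<in> Q. tr F l \<gamma> k = k} \<noteq> {\<gamma> \<in> Q. tr G l \<gamma> k = k}}) / real (m l)" for l
      proof -
        have "{1..m l} \<noteq> {}" using bm[of l] ne[of l] by (auto simp: bij_betw_def)
        from tv_dist_map_pmf_le[OF finite_atLeastAtMost this, of "Pow Q"] Q(1)
        show ?thesis unfolding stab_pmf_def by simp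
      qed
      then show "\<forall>\<^sub>F l in sequentially. tv_dist (Pow Q) (stab_pmf (m l) (tr F l) Q) (stab_pmf (m l) (tr G l) Q)
        \<le> real (card {k \<in> {1..m l}. {\<gamma> \<in> Q. tr F l \<gamma> k = k} \<noteq> {\<gamma> \<in> Q. tr G l \<gamma> k = k}}) / real (m l)"
        by (rule always_eventually[OF allI])
    qed
  qed
  have "\<exists>g. (\<forall>l. g l \<in> hom K (sym_group (m l))) \<and>
      (\<forall>Q. finite Q \<and> Q \<subseteq> carrier K \<longrightarrow>
        (\<lambda>l. tv_dist (Pow Q) (stab_pmf (m l) (tr F l) Q) (stab_pmf (m l) (g l) Q)) \<longlonglongrightarrow> 0)"
    by (rule exI[of _ "tr G"], intro conjI allI impI homG, elim conjE, rule tv)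
  note rigid[unfolded UB_flexibly_BS_rigid_def, THEN spec, THEN spec, THEN mp, OF almost, THEN mp, OF this]
  then obtain N h where N: "\<And>l. m l \<le> N l" and h: "\<And>l. h l \<in> hom K (sym_group (N l))"
    and dist: "\<And>x. x \<in> carrier K \<Longrightarrow> (\<lambda>l. perm_dist (m l) (tr F l x) (h l x)) \<longlonglongrightarrow> 0"
    by (elim exE conjE) blast
  show thesis
  proof (rule that[OF inj h])
    fix w assume w: "w \<in> braid_words n" and c: "braid_rel n `` {w} \<in> carrier K"
    have "asymp_all X (\<lambda>l x. tr F l (braid_rel n `` {w}) (\<beta> l x) = h l (braid_rel n `` {w}) (\<beta> l x))"
      using dist[OF c] unfolding asymp_all_def perm_dist_bij[OF bm] .
    then show "asymp_all X (\<lambda>l x. h l (braid_rel n `` {w}) (\<beta> l x) = \<beta> l (eval_word (F l) w x))"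
      by (rule asymp_all_mono2[OF F.fin _ F.braid_eq_asymp_all[OF rep_class(2)[OF w]]]) (simp add: tr)
  qed
qed

section \<open>The action of the pure braids\<close>

fun gen_inv :: "(nat \<Rightarrow> nat \<Rightarrow> nat) \<Rightarrow> nat \<Rightarrow> nat \<Rightarrow> nat \<Rightarrow> point \<Rightarrow> point" where
  "gen_inv \<pi> r p i (j, y, z, u, q) =
    (if i < r then (j, inv' (\<pi> i) y, z, u, q)
     else if i = r then ((j - q * int y) mod int p, y, z, u, q)
     else (j, y, z \<noteq> (j < int (p div 2)), u, q))"

datatype pure_gen = A | B | T

text \<open>The levels \<open>i\<close> let one generator \<open>B\<close> carry all
  \<open>r + 2\<close> maps, since conjugation by a power of \<open>A\<close> brings level
  \<open>i\<close> to level 0. The flag selects the almost action, where \<open>T\<close> shifts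
  \<open>j\<close>, or the true action, where \<open>T\<close> shifts the inert \<open>u\<close>.
  Adding \<open>r + 1\<close> is the step back modulo \<open>r + 2\<close>.\<close>

fun pure_act :: "bool \<Rightarrow> (nat \<Rightarrow> nat \<Rightarrow> nat) \<Rightarrow> nat \<Rightarrow> nat \<Rightarrow> pure_gen \<times> bool \<Rightarrow> nat \<times> point \<Rightarrow> nat \<times> point" where
  "pure_act fl \<pi> r p (A, True) (i, \<xi>) = ((i + 1) mod (r + 2), \<xi>)"
| "pure_act fl \<pi> r p (A, False) (i, \<xi>) = ((i + (r + 1)) mod (r + 2), \<xi>)"
| "pure_act fl \<pi> r p (B, True) (i, \<xi>) = (i, gen \<pi> r p i \<xi>)"
| "pure_act fl \<pi> r p (B, False) (i, \<xi>) = (i, gen_inv \<pi> r p i \<xi>)"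
| "pure_act fl \<pi> r p (T, b) (i, j, y, z, u, q) =
    (if fl then (i, (j + (if b then 1 else - 1)) mod int p, y, z, u, q)
     else (i, j, y, z, (u + (if b then 1 else - 1)) mod int p, q))"

definition level_points :: "nat \<Rightarrow> nat \<Rightarrow> (nat \<times> point) set" where
  "level_points r p = {..<r + 2} \<times> points p"

text \<open>
  The almost action and the true action of a word differ by such a shift, except for the few
  trajectories on which \<open>j\<close> comes near an end of one of the two halves of \<open>\<int>/p\<close>.
\<close>

fun kshift :: "nat \<Rightarrow> int \<Rightarrow> nat \<times> point \<Rightarrow> nat \<times> point" where
  "kshift p e (i, j, y, z, u, q) = (i, (j + e) mod int p, y, z, (u - e) mod int p, q)"

fun sgn_T :: "pure_gen \<times> bool \<Rightarrow> int" where
  "sgn_T (T, b) = (if b then 1 else - 1)"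
| "sgn_T _ = 0"

lemma kshift_kshift: "kshift p e (kshift p e' x) = kshift p (e + e') x"
  by (cases x) (auto simp: mod_simps algebra_simps)

lemma kshift_zero: "x \<in> level_points r p \<Longrightarrow> e mod int p = 0 \<Longrightarrow> kshift p e x = x"
  by (cases x) (auto simp: level_points_def points_def mod_add_right_eq[symmetric] mod_diff_right_eq[symmetric]
      simp del: mod_add_right_eq mod_diff_right_eq)

locale construction =
  fixes r :: nat and p :: "nat \<Rightarrow> nat" and \<pi> :: "nat \<Rightarrow> nat \<Rightarrow> nat \<Rightarrow> nat"
  assumes prime: "prime (p l)"
    and lim_p: "filterlim p at_top sequentially"
    and perm: "i < r \<Longrightarrow> \<pi> l i permutes {..<2560 * p l}"
begin

abbreviation X1 where "X1 l \<equiv> level_points r (p l)"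
abbreviation pact where "pact fl l \<equiv> pure_act fl (\<pi> l) r (p l)"

lemma p_pos: "p l > 0" and p_gt_1: "p l > 1"
  using prime[of l] prime_gt_0_nat prime_gt_1_nat by auto

lemma finite_X1: "finite (X1 l)"
  by (simp add: level_points_def finite_points)

lemma gen_closed: "\<xi> \<in> points (p l) \<Longrightarrow> gen (\<pi> l) r (p l) i \<xi> \<in> points (p l)"
  using p_pos[of l] permutes_in_image[OF perm[of i l]] by (cases \<xi>) (auto simp: points_def)

lemma gen_inv_closed: "\<xi> \<in> points (p l) \<Longrightarrow> gen_inv (\<pi> l) r (p l) i \<xi> \<in> points (p l)"
  using p_pos[of l] permutes_in_image[OF permutes_inv[OF perm[of i l]]]
  by (cases \<xi>) (auto simp: points_def)

lemma gen_inverse: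
  assumes "\<xi> \<in> points (p l)"
  shows "gen_inv (\<pi> l) r (p l) i (gen (\<pi> l) r (p l) i \<xi>) = \<xi>"
    and "gen (\<pi> l) r (p l) i (gen_inv (\<pi> l) r (p l) i \<xi>) = \<xi>"
  using assms permutes_inverses[OF perm[of i l]]
  by (cases \<xi>; auto simp: points_def mod_simps)+

lemma pact_closed: "x \<in> X1 l \<Longrightarrow> pact fl l (c, b) x \<in> X1 l"
proof -
  assume x: "x \<in> X1 l"
  obtain i \<xi> where xe: "x = (i, \<xi>)" by (rule prod.exhaust)
  have \<xi>: "i < r + 2" "\<xi> \<in> points (p l)" using x by (auto simp: xe level_points_def)
  show ?thesis
  proof (cases c)
    case T
    then show ?thesis using \<xi> p_pos[of l]
      by (cases \<xi>) (auto simp: xe level_points_def points_def)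
  qed (use \<xi> gen_closed gen_inv_closed in \<open>cases b; simp add: xe level_points_def\<close>)+
qed

lemma A_inverse:
  assumes "i < r + 2"
  shows "((i + 1) mod (r + 2) + (r + 1)) mod (r + 2) = i"
    and "((i + (r + 1)) mod (r + 2) + 1) mod (r + 2) = i"
proof -
  have "(i + 1 + (r + 1)) mod (r + 2) = (i + (r + 2)) mod (r + 2)" by (simp add: ac_simps)
  then have *: "(i + 1 + (r + 1)) mod (r + 2) = i" using assms by (simp only: mod_add_self2 mod_less)
  show "((i + 1) mod (r + 2) + (r + 1)) mod (r + 2) = i" using * by (simp only: mod_add_left_eq)
  show "((i + (r + 1)) mod (r + 2) + 1) mod (r + 2) = i"
    unfolding mod_add_left_eq using * by (simp only: ac_simps)
qed

lemma pact_cancel: "x \<in> X1 l \<Longrightarrow> pact fl l (c, \<not> b) (pact fl l (c, b) x) = x"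
proof -
  assume x: "x \<in> X1 l"
  obtain i j y z u q where xe: "x = (i, j, y, z, u, q)" by (cases x) auto
  have i: "i < r + 2" and \<xi>: "(j, y, z, u, q) \<in> points (p l)"
    using x by (auto simp: xe level_points_def)
  show ?thesis
  proof (cases c)
    case A
    then show ?thesis using A_inverse[OF i] by (cases b) (simp_all add: xe del: One_nat_def)
  next
    case B
    then show ?thesis using gen_inverse[OF \<xi>, of i]
      by (cases b) (simp_all add: xe del: gen.simps gen_inv.simps)
  next
    case T
    then show ?thesis using \<xi> by (cases b) (auto simp: xe points_def mod_simps)
  qed
qed

sublocale pact: signed_letters UNIV X1 "pact fl" for fl
  by unfold_locales (auto simp: finite_X1 pact_closed pact_cancel)

lemma T_A_commute:
  "pact fl l (T, True) (pact fl l (A, b) x) = pact fl l (A, b) (pact fl l (T, True) x)"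
  by (cases x; cases b) auto

lemma T_B_commute:
  "pact False l (T, True) (pact False l (B, b) x) = pact False l (B, b) (pact False l (T, True) x)"
  by (cases x; cases b) auto

section \<open>Comparison of the almost action with the true action\<close>

lemma lim_inverse_p: "(\<lambda>l. c / real (p l)) \<longlonglongrightarrow> 0"
  by (intro real_tendsto_divide_at_top[OF tendsto_const] filterlim_compose[OF filterlim_real_sequentially lim_p])

text \<open>A translation by \<open>e\<close> changes the side of \<open>j\<close> only near the two
  boundaries of the halves: in a window of length \<open>2 * \<bar>e\<bar>\<close> around
  \<open>h\<close> and in two of length \<open>\<bar>e\<bar>\<close> at the ends of the
  range.\<close>

lemma asymp_all_half:
  "asymp_all X1 (\<lambda>l (i, j, y, z, u, q). (j < int (p l div 2)) = ((j + e) mod int (p l) < int (p l div 2)))"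
proof (rule asymp_all_dominated[OF lim_inverse_p[of "4 * real_of_int \<bar>e\<bar>"]])
  fix l
  let ?P = "\<lambda>j. (j < int (p l div 2)) = ((j + e) mod int (p l) < int (p l div 2))"
  let ?J = "{j \<in> {0..<int (p l)}. \<not> ?P j}"
  let ?R = "{..<2560 * p l} \<times> (UNIV :: bool set) \<times> {0..<int (p l)} \<times> {1..<int (p l)}"
  define h where "h = int (p l div 2)"
  have hp: "0 \<le> h" "h \<le> int (p l)" by (auto simp: h_def)
  have "card ?J \<le> 4 * nat \<bar>e\<bar>"
  proof (cases "\<bar>e\<bar> < int (p l)")
    case True
    have "?J \<subseteq> {h - \<bar>e\<bar>..<h + \<bar>e\<bar>} \<union> {0..<\<bar>e\<bar>} \<union> {int (p l) - \<bar>e\<bar>..<int (p l)}"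
    proof
      fix j assume j: "j \<in> ?J"
      have "(j + e) mod int (p l) = (if j + e < 0 then j + e + int (p l)
         else if j + e < int (p l) then j + e else j + e - int (p l))"
        using j True mod_pos_pos_trivial[of "j + e + int (p l)" "int (p l)"]
          mod_pos_pos_trivial[of "j + e - int (p l)" "int (p l)"] by auto
      then show "j \<in> {h - \<bar>e\<bar>..<h + \<bar>e\<bar>} \<union> {0..<\<bar>e\<bar>} \<union> {int (p l) - \<bar>e\<bar>..<int (p l)}"
        using j hp unfolding h_def by (auto split: if_splits)
    qed
    then have "card ?J \<le> card ({h - \<bar>e\<bar>..<h + \<bar>e\<bar>} \<union> {0..<\<bar>e\<bar>} \<union> {int (p l) - \<bar>e\<bar>..<int (p l)})"
      by (intro card_mono) auto
    also have "\<dots> \<le> card {h - \<bar>e\<bar>..<h + \<bar>e\<bar>} + card {0..<\<bar>e\<bar>} + card {int (p l) - \<bar>e\<bar>..<int (p l)}"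
      by (meson card_Un_le add_le_mono le_refl le_trans)
    also have "\<dots> = 4 * nat \<bar>e\<bar>" by simp
    finally show ?thesis .
  next
    case False
    have "card ?J \<le> card {0..<int (p l)}" by (rule card_mono) auto
    also have "\<dots> \<le> 4 * nat \<bar>e\<bar>" using False by simp
    finally show ?thesis .
  qed
  then have cJ: "real (card ?J) \<le> 4 * real_of_int \<bar>e\<bar>" by linarith
  let ?Bad = "{x \<in> X1 l. \<not> (case x of (i, j, y, z, u, q) \<Rightarrow> ?P j)}"
  have "?Bad = {..<r + 2} \<times> ?J \<times> ?R"
    by (auto simp: level_points_def points_def)
  then have b: "card ?Bad = (r + 2) * (card ?J * card ?R)"
    by (simp only: card_cartesian_product card_lessThan)
  have "X1 l = {..<r + 2} \<times> {0..<int (p l)} \<times> ?R"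
    by (simp add: level_points_def points_def)
  then have t: "card (X1 l) = (r + 2) * (p l * card ?R)"
    by (simp only: card_cartesian_product card_lessThan) simp
  have R: "real (card ?R) > 0" using p_gt_1[of l] by simp
  have "real (card ?Bad) / real (card (X1 l)) = real (card ?J) / real (p l)"
  proof -
    have "(d * (a * c)) / (d * (b * c)) = a / b" if "c > 0" "d > 0" for a b c d :: real
      using that by simp
    from this[OF R] show ?thesis unfolding b t of_nat_mult by this simp
  qed
  also have "\<dots> \<le> 4 * real_of_int \<bar>e\<bar> / real (p l)" by (rule divide_right_mono[OF cJ]) simp
  finally show "real (card ?Bad) / real (card (X1 l)) \<le> 4 * real_of_int \<bar>e\<bar> / real (p l)" .
qed

text \<open>Only \<open>B\<close> on the last level tests the position of \<open>j\<close>;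
  everything else ignores or translates \<open>j\<close> and \<open>u\<close> and so commutes with
  \<open>kshift\<close> exactly.\<close>

lemma asymp_all_kshift_commute:
  "asymp_all X1 (\<lambda>l x. pact False l a (kshift (p l) e x) = kshift (p l) e (pact False l a x))"
proof (rule asymp_all_mono[OF finite_X1 asymp_all_half[of e]])
  fix l x assume x: "x \<in> X1 l" and half: "case x of (i, j, y, z, u, q) \<Rightarrow>
    (j < int (p l div 2)) = ((j + e) mod int (p l) < int (p l div 2))"
  obtain c b where a: "a = (c, b)" by force
  show "pact False l a (kshift (p l) e x) = kshift (p l) e (pact False l a x)"
    using half by (cases x; cases c; cases b) (auto simp: a mod_simps algebra_simps)
qed

text \<open>The two actions differ only in \<open>T\<close>, where \<open>kshift\<close> undoes the
  move of \<open>u\<close> and makes the move of \<open>j\<close> instead.\<close>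

lemma pact_True_eq_kshift:
  "x \<in> X1 l \<Longrightarrow> pact True l a x = kshift (p l) (sgn_T a) (pact False l a x)"
proof -
  assume x: "x \<in> X1 l"
  obtain c b where a: "a = (c, b)" by force
  have fx: "pact False l a x \<in> X1 l" using x pact_closed a by blast
  show ?thesis
  proof (cases c)
    case A
    have "pact True l a x = pact False l a x" by (cases x; cases b) (auto simp: a A)
    then show ?thesis using kshift_zero[OF fx, of 0] by (simp add: a A)
  next
    case B
    have "pact True l a x = pact False l a x" by (cases x; cases b) (auto simp: a B)
    then show ?thesis using kshift_zero[OF fx, of 0] by (simp add: a B)
  next
    case T
    then show ?thesis using x by (cases x) (auto simp: a level_points_def points_def mod_simps)
  qed
qed

lemma asymp_all_T_B_commute:
  "asymp_all X1 (\<lambda>l x. pact True l (T, True) (pact True l (B, True) x) = pact True l (B, True) (pact True l (T, True) x))"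
proof (rule asymp_all_mono[OF finite_X1 asymp_all_half[of 1]])
  fix l x assume x: "x \<in> X1 l" and half: "case x of (i, j, y, z, u, q) \<Rightarrow>
    (j < int (p l div 2)) = ((j + 1) mod int (p l) < int (p l div 2))"
  show "pact True l (T, True) (pact True l (B, True) x) = pact True l (B, True) (pact True l (T, True) x)"
    using half by (cases x) (auto simp: mod_simps algebra_simps)
qed

text \<open>Induction on the word: the shift accumulated by \<open>W\<close> is pulled through the
  next letter, which fails only on the preimage of a negligible set under the true action of
  \<open>W\<close>.\<close>

lemma eval_word_True_eq_kshift:
  "asymp_all X1 (\<lambda>l x. eval_word (pact True l) W x = kshift (p l) (\<Sum>a\<leftarrow>W. sgn_T a) (eval_word (pact False l) W x))"
proof (induction W)
  case Nil
  show ?case by (rule asymp_all_always) (simp add: kshift_zero)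
next
  case (Cons a W)
  have W: "W \<in> lists (UNIV \<times> UNIV)" by auto
  show ?case
  proof (rule asymp_all_mono2[OF finite_X1 Cons.IH
        pact.asymp_all_eval_word[OF W asymp_all_kshift_commute[of a "\<Sum>a\<leftarrow>W. sgn_T a"], of False]])
    fix l x assume x: "x \<in> X1 l"
      and 1: "eval_word (pact True l) W x = kshift (p l) (\<Sum>a\<leftarrow>W. sgn_T a) (eval_word (pact False l) W x)"
      and 2: "pact False l a (kshift (p l) (\<Sum>a\<leftarrow>W. sgn_T a) (eval_word (pact False l) W x))
        = kshift (p l) (\<Sum>a\<leftarrow>W. sgn_T a) (pact False l a (eval_word (pact False l) W x))"
    have "eval_word (pact True l) W x \<in> X1 l" by (rule pact.eval_word_in[OF W x])
    then have "eval_word (pact True l) (a # W) x = kshift (p l) (sgn_T a) (pact False l a (eval_word (pact True l) W x))"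
      using pact_True_eq_kshift by simp
    then show "eval_word (pact True l) (a # W) x = kshift (p l) (\<Sum>a\<leftarrow>a # W. sgn_T a) (eval_word (pact False l) (a # W) x)"
      using 1 2 by (simp add: kshift_kshift)
  qed
qed

text \<open>Wherever the almost action is a \<open>kshift\<close> of the true one, a fixed point of
  the true action then forces \<open>p\<close> to divide the amount of that shift.\<close>

lemma eval_word_True_fixes_u:
  "(case eval_word (pact True l) W (i, j, y, z, u, q) of (i', j', y', z', u', q') \<Rightarrow> u') = u"
proof (induction W)
  case (Cons a W)
  obtain c b where a: "a = (c, b)" by force
  obtain i' j' y' z' u' q' where e: "eval_word (pact True l) W (i, j, y, z, u, q) = (i', j', y', z', u', q')"
    by (cases "eval_word (pact True l) W (i, j, y, z, u, q)") auto
  show ?case using Cons by (cases c; cases b) (auto simp: e a)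
qed simp

text \<open>The true action is a skew product over the moves of \<open>(i, y)\<close>, with a
  cocycle in \<open>j\<close> that is linear in \<open>q\<close>: neither \<open>\<tau>\<close> nor
  \<open>\<mu>\<close> depends on \<open>q\<close>. This is what makes a random scalar
  \<open>q\<close> useful.\<close>

lemma eval_word_False_skew:
  "\<exists>\<tau> \<mu>. \<forall>i j y z u q. (i, j, y, z, u, q) \<in> X1 l \<longrightarrow>
    (\<exists>i' j' y' z' u'. eval_word (pact False l) W (i, j, y, z, u, q) = (i', j', y', z', u', q) \<and>
      (i', y') = \<tau> (i, y) \<and> j' = (j + q * \<mu> (i, y)) mod int (p l))"
proof (induction W)
  case Nil
  show ?case
    by (rule exI[of _ id], rule exI[of _ "\<lambda>_. 0"]) (auto simp: level_points_def points_def)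
next
  case (Cons a W)
  then obtain \<tau> \<mu> where IH: "\<And>i j y z u q. (i, j, y, z, u, q) \<in> X1 l \<Longrightarrow>
    (\<exists>i' j' y' z' u'. eval_word (pact False l) W (i, j, y, z, u, q) = (i', j', y', z', u', q) \<and>
      (i', y') = \<tau> (i, y) \<and> j' = (j + q * \<mu> (i, y)) mod int (p l))"
    by blast
  obtain c b where a: "a = (c, b)" by force
  define \<tau>1 where "\<tau>1 = (\<lambda>(i, y). case c of
     A \<Rightarrow> (if b then (i + 1) mod (r + 2) else (i + (r + 1)) mod (r + 2), y)
   | B \<Rightarrow> (i, if i < r then (if b then \<pi> l i y else inv' (\<pi> l i) y) else y)
   | T \<Rightarrow> (i, y))"
  define \<mu>1 where "\<mu>1 = (\<lambda>(i :: nat, y). if c = B \<and> i = r then (if b then int y else - int y) else 0)"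
  show ?case
  proof (rule exI[of _ "\<tau>1 \<circ> \<tau>"], rule exI[of _ "\<lambda>w. \<mu> w + \<mu>1 (\<tau> w)"], intro allI impI)
    fix i j y z u q assume x: "(i, j, y, z, u, q) \<in> X1 l"
    obtain i' j' y' z' u' where e: "eval_word (pact False l) W (i, j, y, z, u, q) = (i', j', y', z', u', q)"
      "\<tau> (i, y) = (i', y')" "j' = (j + q * \<mu> (i, y)) mod int (p l)"
      using IH[OF x] by metis
    have j': "j' mod int (p l) = j'" using e(3) by simp
    have "j' = (j + q * (\<mu> (i, y) + 0)) mod int (p l)" using e(3) by simp
    moreover have "(j' + q * int y') mod int (p l) = (j + q * (\<mu> (i, y) + int y')) mod int (p l)"
      "(j' - q * int y') mod int (p l) = (j + q * (\<mu> (i, y) - int y')) mod int (p l)"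
      unfolding e(3) by (simp_all add: mod_simps algebra_simps)
    ultimately show "\<exists>i' j' y' z' u'. eval_word (pact False l) (a # W) (i, j, y, z, u, q) = (i', j', y', z', u', q) \<and>
      (i', y') = (\<tau>1 \<circ> \<tau>) (i, y) \<and> j' = (j + q * (\<mu> (i, y) + \<mu>1 (\<tau> (i, y)))) mod int (p l)"
      by (cases c; cases b) (auto simp: a e(1,2) \<tau>1_def \<mu>1_def)
  qed
qed

text \<open>If \<open>p\<close> divides the exponent sum \<open>\<epsilon>\<close> of
  \<open>T\<close>, the connecting shift is trivial. Otherwise neither action fixes a typical point:
  for the true one \<open>u\<close> forbids it, and a fixed point of the almost action needs
  \<open>q * \<mu> (i, y)\<close> to be congruent to \<open>- \<epsilon>\<close>, which leaves at
  most one of the \<open>p - 1\<close> values of \<open>q\<close>.\<close>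

lemma asymp_all_fixed_points_eq:
  "asymp_all X1 (\<lambda>l x. (eval_word (pact True l) W x = x) = (eval_word (pact False l) W x = x))"
proof -
  define \<epsilon> where "\<epsilon> = (\<Sum>a\<leftarrow>W. sgn_T a)"
  define N where "N l x \<longleftrightarrow> \<not> (eval_word (pact False l) W x = kshift (p l) (- \<epsilon>) x \<and> \<epsilon> mod int (p l) \<noteq> 0)" for l x
  have W: "W \<in> lists (UNIV \<times> UNIV)" by auto
  have "asymp_all X1 N"
  proof (rule asymp_all_dominated)
    have "filterlim (\<lambda>l. - 1 + real (p l)) at_top sequentially"
      by (intro filterlim_tendsto_add_at_top[OF tendsto_const]
          filterlim_compose[OF filterlim_real_sequentially lim_p])
    then show "(\<lambda>l. 1 / (- 1 + real (p l))) \<longlonglongrightarrow> 0"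
      by (rule real_tendsto_divide_at_top[OF tendsto_const])
    fix l
    let ?Bad = "{x \<in> X1 l. \<not> N l x}"
    let ?R = "{..<r + 2} \<times> {0..<int (p l)} \<times> {..<2560 * p l} \<times> (UNIV :: bool set) \<times> {0..<int (p l)}"
    obtain \<tau> \<mu> where sk: "\<And>i j y z u q. (i, j, y, z, u, q) \<in> X1 l \<Longrightarrow>
      (\<exists>i' j' y' z' u'. eval_word (pact False l) W (i, j, y, z, u, q) = (i', j', y', z', u', q) \<and>
        (i', y') = \<tau> (i, y) \<and> j' = (j + q * \<mu> (i, y)) mod int (p l))"
      using eval_word_False_skew[of l W] by blast
    have key: "[q * \<mu> (i, y) = - \<epsilon>] (mod int (p l)) \<and> \<epsilon> mod int (p l) \<noteq> 0"
      if x: "(i, j, y, z, u, q) \<in> ?Bad" for i j y z u q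
    proof -
      have *: "eval_word (pact False l) W (i, j, y, z, u, q) = kshift (p l) (- \<epsilon>) (i, j, y, z, u, q) \<and>
          \<epsilon> mod int (p l) \<noteq> 0" using CollectD[OF x] unfolding N_def not_not by (rule conjunct2)
      then have "(j + q * \<mu> (i, y)) mod int (p l) = (j + - \<epsilon>) mod int (p l)"
        using sk[of i j y z u q] x by auto
      then have "[j + q * \<mu> (i, y) = j + - \<epsilon>] (mod int (p l))" by (simp add: cong_def)
      from cong_add_lcancel[THEN iffD1, OF this] * show ?thesis by simp
    qed
    have "card ?Bad \<le> card ?R"
    proof (rule card_inj_on_le[of "\<lambda>(i, j, y, z, u, q). (i, j, y, z, u)"])
      show "inj_on (\<lambda>(i, j, y, z, u, q). (i, j, y, z, u)) ?Bad"
      proof (rule inj_onI)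
        fix x x' assume x: "x \<in> ?Bad" "x' \<in> ?Bad"
          "(case x of (i, j, y, z, u, q) \<Rightarrow> (i, j, y, z, u)) = (case x' of (i, j, y, z, u, q) \<Rightarrow> (i, j, y, z, u))"
        obtain i j y z u q where xe: "x = (i, j, y, z, u, q)" by (cases x) auto
        obtain q' where xe': "x' = (i, j, y, z, u, q')" using x(3) by (cases x') (auto simp: xe)
        have k: "[q * \<mu> (i, y) = - \<epsilon>] (mod int (p l))" "[q' * \<mu> (i, y) = - \<epsilon>] (mod int (p l))"
          "\<epsilon> mod int (p l) \<noteq> 0"
          using key[OF x(1)[unfolded xe]] key[OF x(2)[unfolded xe']] by simp_all
        \<comment> \<open>A multiple of \<open>\<mu> (i, y)\<close> is congruent to the non-zero
          residue of \<open>- \<epsilon>\<close>, so \<open>\<mu> (i, y)\<close> is a unit modulo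
          the prime and the congruence determines \<open>q\<close>.\<close>
        have "\<not> int (p l) dvd \<mu> (i, y)"
        proof
          assume "int (p l) dvd \<mu> (i, y)"
          then have "[q * \<mu> (i, y) = 0] (mod int (p l))" by (simp add: cong_0_iff)
          from cong_trans[OF cong_sym[OF k(1)] this] have "int (p l) dvd - \<epsilon>"
            by (simp only: cong_0_iff)
          then have "int (p l) dvd \<epsilon>" by simp
          then show False using k(3) by (simp add: dvd_eq_mod_eq_0)
        qed
        then have "coprime (int (p l)) (\<mu> (i, y))"
          using prime[of l] by (intro prime_imp_coprime) auto
        then have cop: "coprime (\<mu> (i, y)) (int (p l))" by (rule coprime_commute[THEN iffD1])
        have "[q * \<mu> (i, y) = q' * \<mu> (i, y)] (mod int (p l))"
          using k(1) k(2)[THEN cong_sym] by (rule cong_trans)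
        then have "[q = q'] (mod int (p l))" by (rule cong_mult_rcancel[OF cop, THEN iffD1])
        then show "x = x'" using x(1,2) unfolding xe xe'
          by (auto simp: cong_def level_points_def points_def)
      qed
    qed (auto simp: level_points_def points_def)
    then have le: "real (card ?Bad) \<le> real (card ?R)" by (simp only: of_nat_le_iff)
    have p1: "real (p l) > 1" using p_gt_1[of l] by simp
    have "(0, 0, 0, True, 0) \<in> ?R" "finite ?R" using p_gt_1[of l] by auto
    then have "card ?R > 0" unfolding card_gt_0_iff by blast
    then have R: "real (card ?R) > 0" by (simp only: of_nat_0_less_iff)
    have "card {1..<int (p l)} = p l - 1" by simp
    then have "card (X1 l) = card ?R * (p l - 1)"
      unfolding level_points_def points_def card_cartesian_product by (simp only: mult.assoc)
    then have cX: "real (card (X1 l)) = real (card ?R) * (- 1 + real (p l))"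
      using p_gt_1[of l] by (simp add: of_nat_diff)
    have "real (card ?Bad) / real (card (X1 l)) \<le> real (card ?R) / real (card (X1 l))"
      using le by (rule divide_right_mono) simp
    also have "\<dots> = 1 / (- 1 + real (p l))" unfolding cX using R p1 by simp
    finally show "real (card ?Bad) / real (card (X1 l)) \<le> 1 / (- 1 + real (p l))" .
  qed
  then show ?thesis
  proof (rule asymp_all_mono2[OF finite_X1 _ eval_word_True_eq_kshift[of W]])
    fix l x assume x: "x \<in> X1 l" and Nx: "N l x"
      and F: "eval_word (pact True l) W x = kshift (p l) (\<Sum>a\<leftarrow>W. sgn_T a) (eval_word (pact False l) W x)"
    have gX: "eval_word (pact False l) W x \<in> X1 l" by (rule pact.eval_word_in[OF W x])
    have F: "eval_word (pact True l) W x = kshift (p l) \<epsilon> (eval_word (pact False l) W x)" using F by (simp add: \<epsilon>_def)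
    show "(eval_word (pact True l) W x = x) = (eval_word (pact False l) W x = x)"
    proof (cases "\<epsilon> mod int (p l) = 0")
      case True
      then show ?thesis using F kshift_zero[OF gX] by simp
    next
      case False
      have "eval_word (pact True l) W x \<noteq> x"
      proof
        assume "eval_word (pact True l) W x = x"
        then have "kshift (p l) (- \<epsilon>) x = kshift (p l) (- \<epsilon> + \<epsilon>) (eval_word (pact False l) W x)"
          using F kshift_kshift by metis
        then have "kshift (p l) (- \<epsilon>) x = eval_word (pact False l) W x" using kshift_zero[OF gX, of 0] by simp
        then show False using Nx False by (simp add: N_def)
      qed
      moreover have "eval_word (pact False l) W x \<noteq> x"
      proof
        assume g: "eval_word (pact False l) W x = x"
        obtain i j y z u q where xe: "x = (i, j, y, z, u, q)" by (cases x) auto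
        have "(u - \<epsilon>) mod int (p l) = u"
          using eval_word_True_fixes_u[of l W i j y z u q] F g by (simp add: xe)
        then have "(u - \<epsilon>) mod int (p l) = u mod int (p l)" using mod_mod_trivial by metis
        then have "[u + - \<epsilon> = u + 0] (mod int (p l))" by (simp add: cong_def)
        then have "[- \<epsilon> = 0] (mod int (p l))" by (rule cong_add_lcancel[THEN iffD1])
        then have "int (p l) dvd \<epsilon>" by (simp add: cong_0_iff)
        then show False using False by (simp add: dvd_eq_mod_eq_0)
      qed
      ultimately show ?thesis by simp
    qed
  qed
qed

text \<open>The last letter acts first: \<open>A\<close> climbs from level 0 to level
  \<open>i\<close>, \<open>B\<close> applies the generator found there, and the inverses of
  \<open>A\<close> descend again.\<close>

lemma eval_word_level:
  assumes "i < r + 2"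
  shows "eval_word (pact fl l) (replicate i (A, False) @ (B, True) # replicate i (A, True)) (0, \<xi>) = (0, gen (\<pi> l) r (p l) i \<xi>)"
proof -
  have up: "k < r + 2 \<Longrightarrow> eval_word (pact fl l) (replicate k (A, True)) (0, \<xi>) = (k, \<xi>)" for k \<xi>
    by (induction k) auto
  have down: "k < r + 2 \<Longrightarrow> eval_word (pact fl l) (replicate k (A, False)) (k, \<xi>) = (0, \<xi>)" for k \<xi>
  proof (induction k)
    case (Suc k)
    have "eval_word (pact fl l) (replicate (Suc k) (A, False)) (Suc k, \<xi>)
       = eval_word (pact fl l) (replicate k (A, False)) (pact fl l (A, False) (Suc k, \<xi>))"
    proof -
      have "replicate (Suc k) (A, False) = replicate k (A, False) @ [(A, False)]"
        by (simp add: replicate_append_same)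
      then show ?thesis by (simp only: eval_word_append eval_word_Cons eval_word_Nil)
    qed
    moreover have "pact fl l (A, False) (Suc k, \<xi>) = (k, \<xi>)"
    proof -
      have "(Suc k + (r + 1)) mod (r + 2) = (k + (r + 2)) mod (r + 2)" by (simp add: ac_simps)
      also have "\<dots> = k" using Suc.prems by (simp only: mod_add_self2 mod_less Suc_lessD)
      finally show ?thesis by simp
    qed
    ultimately show ?case using Suc by simp
  qed simp
  show ?thesis using up[OF assms] down[OF assms] by simp
qed

end

section \<open>Marked strands\<close>

datatype vertex = V0 | V1 | V2 | V3 | V4 | V5

lemma UNIV_vertex: "UNIV = {V0, V1, V2, V3, V4, V5}"
  using vertex.exhaust by blast

text \<open>
  The six orders in which three marked strands can lie form a hexagon \<open>V0, \<dots>, V5\<close> whose edges are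
  alternately crossings of the first two (\<open>False\<close>) and of the last two (\<open>True\<close>) of them; the second
  argument is the sign of the crossing. The forward edges are gauged to act trivially, except for the
  one from \<open>V5\<close> to \<open>V0\<close>, so that a full turn is \<open>T\<close>. The braid relation at the six
  vertices then determines the labels of the backward edges from those of the first two.
\<close>

fun edge :: "bool \<Rightarrow> bool \<Rightarrow> vertex \<Rightarrow> vertex \<times> (pure_gen \<times> bool) list" where
  "edge False True V0 = (V1, [])"
| "edge False True V1 = (V0, [(A, True)])"
| "edge False True V2 = (V3, [])"
| "edge False True V3 = (V2, [(B, False), (A, False), (T, True)])"
| "edge False True V4 = (V5, [])"
| "edge False True V5 = (V4, [(B, True)])"
| "edge False False V0 = (V1, [(A, False)])"
| "edge False False V1 = (V0, [])"
| "edge False False V2 = (V3, [(T, False), (A, True), (B, True)])"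
| "edge False False V3 = (V2, [])"
| "edge False False V4 = (V5, [(B, False)])"
| "edge False False V5 = (V4, [])"
| "edge True True V1 = (V2, [])"
| "edge True True V2 = (V1, [(B, True)])"
| "edge True True V3 = (V4, [])"
| "edge True True V4 = (V3, [(A, True)])"
| "edge True True V5 = (V0, [(T, True)])"
| "edge True True V0 = (V5, [(B, False), (A, False)])"
| "edge True False V1 = (V2, [(B, False)])"
| "edge True False V2 = (V1, [])"
| "edge True False V3 = (V4, [(A, False)])"
| "edge True False V4 = (V3, [])"
| "edge True False V5 = (V0, [(A, True), (B, True)])"
| "edge True False V0 = (V5, [(T, False)])"

definition swap :: "nat \<Rightarrow> nat set \<Rightarrow> nat set" where
  "swap i S = Transposition.transpose i (Suc i) ` S"

text \<open>When \<open>i\<close> and \<open>Suc i\<close> are two of three marked positions, this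
  tells whether they are the last two or the first two; it is the first argument of
  \<open>edge\<close>.\<close>

definition below :: "nat set \<Rightarrow> nat \<Rightarrow> bool" where
  "below S i \<longleftrightarrow> (\<exists>k\<in>S. k < i)"

text \<open>A state places three labelled strands, so the resulting action is induced from the
  braids that fix three strands. Crossings involving an unmarked strand have the empty label, as if
  that strand were forgotten.\<close>

fun step :: "nat \<times> bool \<Rightarrow> nat set \<times> vertex \<Rightarrow> (nat set \<times> vertex) \<times> (pure_gen \<times> bool) list" where
  "step (i, b) (S, v) = (if i \<in> S \<and> Suc i \<in> S
    then (case edge (below S i) b v of (v', W) \<Rightarrow> ((S, v'), W))
    else ((swap i S, v), []))"

definition states :: "nat \<Rightarrow> (nat set \<times> vertex) set" where
  "states n = {S. S \<subseteq> {1..n} \<and> card S = 3} \<times> UNIV"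

lemma finite_states: "finite (states n)"
  unfolding states_def UNIV_vertex by (intro finite_cartesian_product) (auto intro: finite_subset[of _ "Pow {1..n}"])

lemma mem_swap: "k \<in> swap i S \<longleftrightarrow> Transposition.transpose i (Suc i) k \<in> S"
  unfolding swap_def by (metis image_iff transpose_involutory)

lemma mem_swap_simps [simp]:
  "i \<in> swap i S \<longleftrightarrow> Suc i \<in> S" "Suc i \<in> swap i S \<longleftrightarrow> i \<in> S"
  by (simp_all add: mem_swap)

lemma mem_swap_other: "k \<noteq> i \<Longrightarrow> k \<noteq> Suc i \<Longrightarrow> k \<in> swap i S \<longleftrightarrow> k \<in> S"
  by (simp add: mem_swap)

lemma swap_swap [simp]: "swap i (swap i S) = S"
  by (auto simp: mem_swap)

lemma swap_commute: "i + 2 \<le> j \<Longrightarrow> swap i (swap j S) = swap j (swap i S)"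
proof -
  assume "i + 2 \<le> j"
  then have "Transposition.transpose j (Suc j) (Transposition.transpose i (Suc i) x) =
    Transposition.transpose i (Suc i) (Transposition.transpose j (Suc j) x)" for x
    by (auto simp: Transposition.transpose_def)
  then show ?thesis by (simp add: set_eq_iff mem_swap)
qed

lemma swap_braid: "swap i (swap (Suc i) (swap i S)) = swap (Suc i) (swap i (swap (Suc i) S))"
proof -
  have "Transposition.transpose i (Suc i) (Transposition.transpose (Suc i) (Suc (Suc i))
      (Transposition.transpose i (Suc i) x)) = Transposition.transpose (Suc i) (Suc (Suc i))
      (Transposition.transpose i (Suc i) (Transposition.transpose (Suc i) (Suc (Suc i)) x))" for x
    by (auto simp: Transposition.transpose_def)
  then show ?thesis by (simp add: set_eq_iff mem_swap)
qed

lemma card_swap [simp]: "card (swap i S) = card S"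
  unfolding swap_def by (rule card_image) simp

lemma swap_subset: "S \<subseteq> {1..n} \<Longrightarrow> i \<in> {1..<n} \<Longrightarrow> swap i S \<subseteq> {1..n}"
  by (auto simp: swap_def Transposition.transpose_def)

lemma below_swap: "i \<le> j \<or> Suc j < i \<Longrightarrow> below (swap j S) i \<longleftrightarrow> below S i"
proof -
  assume *: "i \<le> j \<or> Suc j < i"
  have "below S i" if b: "below (swap j S) i" for S
  proof -
    obtain k where k: "k \<in> swap j S" "k < i" using b by (auto simp: below_def)
    have "Transposition.transpose j (Suc j) k < i" using k * by (auto simp: Transposition.transpose_def)
    then show ?thesis using k(1) by (auto simp: below_def mem_swap)
  qed
  from this[of S] this[of "swap j S"] show ?thesis by auto
qed

lemma below_Suc: "below S (Suc i) \<longleftrightarrow> i \<in> S \<or> below S i"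
  by (auto simp: below_def less_Suc_eq)

lemma step_states:
  assumes "i \<in> {1..<n}" "st \<in> states n"
  shows "fst (step (i, b) st) \<in> states n"
proof -
  obtain S v where st: "st = (S, v)" by (rule prod.exhaust)
  have S: "S \<subseteq> {1..n}" "card S = 3" using assms(2) by (auto simp: st states_def)
  have "swap i S \<subseteq> {1..n}" by (rule swap_subset[OF S(1) assms(1)])
  then show ?thesis using S by (auto simp: st states_def split: prod.splits)
qed

section \<open>The induced action of the braid group\<close>

context construction
begin

definition act :: "bool \<Rightarrow> nat \<Rightarrow> nat \<times> bool \<Rightarrow> (nat set \<times> vertex) \<times> (nat \<times> point) \<Rightarrow> (nat set \<times> vertex) \<times> (nat \<times> point)" where
  "act fl l a = (\<lambda>(st, x). (fst (step a st), eval_word (pact fl l) (snd (step a st)) x))"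

lemma act_cross:
  "i \<in> S \<Longrightarrow> Suc i \<in> S \<Longrightarrow> act fl l (i, b) ((S, v), x) =
    ((S, fst (edge (below S i) b v)), eval_word (pact fl l) (snd (edge (below S i) b v)) x)"
  by (simp add: act_def split: prod.splits)

lemma act_move: "\<not> (i \<in> S \<and> Suc i \<in> S) \<Longrightarrow> act fl l (i, b) ((S, v), x) = ((swap i S, v), x)"
  by (auto simp: act_def)

abbreviation Xn where "Xn n l \<equiv> states n \<times> X1 l"

lemma pact_cancel_simps [simp]:
  assumes "x \<in> X1 l"
  shows "pact fl l (c, False) (pact fl l (c, True) x) = x" "pact fl l (c, True) (pact fl l (c, False) x) = x"
  using pact_cancel[OF assms, of fl c True] pact_cancel[OF assms, of fl c False] by simp_all

lemma act_closed: "i \<in> {1..<n} \<Longrightarrow> x \<in> Xn n l \<Longrightarrow> act fl l (i, b) x \<in> Xn n l"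
  by (cases x) (auto simp: act_def intro!: step_states pact.eval_word_in simp del: step.simps)

lemma act_cancel:
  assumes "i \<in> {1..<n}" "x \<in> Xn n l"
  shows "act fl l (i, \<not> b) (act fl l (i, b) x) = x"
proof -
  obtain S v \<xi> where x: "x = ((S, v), \<xi>)" by (metis prod.exhaust)
  have \<xi>: "\<xi> \<in> X1 l" using assms by (simp add: x)
  show ?thesis
  proof (cases "i \<in> S \<and> Suc i \<in> S")
    case True
    then show ?thesis using \<xi>
      by (cases v; cases b; cases "below S i") (simp_all add: x act_def pact_closed del: pure_act.simps)
  next
    case False
    then show ?thesis by (auto simp: x act_def)
  qed
qed

lemma act_letters: "signed_letters {1..<n} (Xn n) (act fl)"
  by unfold_locales
    (use finite_states finite_X1 act_closed act_cancel in \<open>auto simp del: atLeastLessThan_iff\<close>)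

text \<open>Four distinct positions cannot all lie in a set of three, so at most one of the two
  crossings carries a label, and the other changes neither the marking there nor the value of
  \<open>below\<close>.\<close>

lemma act_commute:
  assumes "i + 2 \<le> j" "x \<in> Xn n l"
  shows "act fl l (i, True) (act fl l (j, True) x) = act fl l (j, True) (act fl l (i, True) x)"
proof -
  obtain S v \<xi> where x: "x = ((S, v), \<xi>)" by (metis prod.exhaust)
  have S: "card S = 3" "finite S" using assms(2) by (auto simp: x states_def intro: card_ge_0_finite)
  have ij: "i \<noteq> j" "Suc i \<noteq> j" "i \<noteq> Suc j" using assms(1) by auto
  have mem: "i \<in> swap j S \<longleftrightarrow> i \<in> S" "Suc i \<in> swap j S \<longleftrightarrow> Suc i \<in> S"
    "j \<in> swap i S \<longleftrightarrow> j \<in> S" "Suc j \<in> swap i S \<longleftrightarrow> Suc j \<in> S"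
    using assms(1) by (auto simp: mem_swap_other)
  have below: "below (swap j S) i = below S i" "below (swap i S) j = below S j"
    using assms(1) by (auto simp: below_swap)
  have "\<not> {i, Suc i, j, Suc j} \<subseteq> S"
  proof
    assume "{i, Suc i, j, Suc j} \<subseteq> S"
    then have "card {i, Suc i, j, Suc j} \<le> 3" using S card_mono by metis
    then show False using ij by simp
  qed
  then consider "i \<in> S" "Suc i \<in> S" "\<not> (j \<in> S \<and> Suc j \<in> S)" | "\<not> (i \<in> S \<and> Suc i \<in> S)" "j \<in> S" "Suc j \<in> S"
    | "\<not> (i \<in> S \<and> Suc i \<in> S)" "\<not> (j \<in> S \<and> Suc j \<in> S)" by blast
  then show ?thesis
  proof cases
    case 1
    then show ?thesis by (simp add: x act_move[OF 1(3)] act_cross mem below)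
  next
    case 2
    then show ?thesis by (simp add: x act_move[OF 2(1)] act_cross mem below)
  next
    case 3
    have 4: "\<not> (i \<in> swap j S \<and> Suc i \<in> swap j S)" "\<not> (j \<in> swap i S \<and> Suc j \<in> swap i S)"
      using 3 mem by auto
    show ?thesis
      by (simp only: x act_move[OF 3(1)] act_move[OF 3(2)] act_move[OF 4(1)] act_move[OF 4(2)]
          swap_commute[OF assms(1)])
  qed
qed

text \<open>With at most two marked strands among the three positions, the relation only slides
  their crossing along. With all three, \<open>below S i\<close> is false and the relation is
  checked at the six vertices, where \<open>T\<close> commutes with \<open>A\<close> exactly and
  with \<open>B\<close> by the hypothesis on the point.\<close>

lemma act_braid:
  assumes x: "x \<in> Xn n l"
    and TB: "pact fl l (T, True) (pact fl l (B, True) (snd x)) = pact fl l (B, True) (pact fl l (T, True) (snd x))"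
  shows "act fl l (i, True) (act fl l (Suc i, True) (act fl l (i, True) x)) =
    act fl l (Suc i, True) (act fl l (i, True) (act fl l (Suc i, True) x))"
proof -
  obtain S v \<xi> where xe: "x = ((S, v), \<xi>)" by (metis prod.exhaust)
  have S: "card S = 3" "finite S" and \<xi>: "\<xi> \<in> X1 l"
    using x by (auto simp: xe states_def intro: card_ge_0_finite)
  let ?j = "Suc i"
  let ?k = "Suc (Suc i)"
  note [simp del] = pure_act.simps
  have mem: "?k \<in> swap i U \<longleftrightarrow> ?k \<in> U" "i \<in> swap ?j U \<longleftrightarrow> i \<in> U" for U
    by (auto simp: mem_swap_other)
  have b: "below (swap ?j U) i = below U i" "below (swap i U) i = below U i" for U
    by (simp_all add: below_swap)
  note simps = xe mem b below_Suc act_cross act_move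
  show ?thesis
  proof (cases "i \<in> S"; cases "?j \<in> S"; cases "?k \<in> S")
    assume S3: "i \<in> S" "?j \<in> S" "?k \<in> S"
    have "{i, ?j, ?k} = S"
      by (rule card_subset_eq[OF S(2)]) (use S3 S(1) in auto)
    then have nb: "\<not> below S i" by (auto simp: below_def)
    have TB: "pact fl l (T, True) (pact fl l (B, True) \<xi>) = pact fl l (B, True) (pact fl l (T, True) \<xi>)"
      using TB by (simp add: xe)
    show ?thesis using S3 nb \<xi>
      by (cases v) (simp_all add: simps T_A_commute TB pact_closed)
  qed (simp_all add: simps swap_braid)
qed

lemma almost_braid_action_act: "almost_braid_action n (Xn n) (act True)"
proof (intro almost_braid_action.intro act_letters almost_braid_action_axioms.intro)
  fix i j assume "i \<in> {1..<n}" "j \<in> {1..<n}" "i + 2 \<le> j"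
  then show "asymp_all (Xn n) (\<lambda>l x. act True l (i, True) (act True l (j, True) x) = act True l (j, True) (act True l (i, True) x))"
    by (intro asymp_all_always act_commute)
next
  fix i assume "i \<in> {1..<n}" "i + 1 \<in> {1..<n}"
  show "asymp_all (Xn n) (\<lambda>l x. act True l (i, True) (act True l (i + 1, True) (act True l (i, True) x)) =
    act True l (i + 1, True) (act True l (i, True) (act True l (i + 1, True) x)))"
  proof (rule asymp_all_mono)
    show "finite (Xn n l)" for l using finite_states finite_X1 by auto
    show "asymp_all (Xn n) (\<lambda>l x. pact True l (T, True) (pact True l (B, True) (snd x)) = pact True l (B, True) (pact True l (T, True) (snd x)))"
      by (rule asymp_all_Times[OF finite_states finite_X1]) (use asymp_all_T_B_commute in simp)
  qed (use act_braid in simp)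
qed

lemma braid_action_act: "braid_action n (Xn n) (act False)"
proof (intro braid_action.intro act_letters braid_action_axioms.intro)
  show "act False l (i, True) (act False l (j, True) x) = act False l (j, True) (act False l (i, True) x)"
    if "i + 2 \<le> j" "x \<in> Xn n l" for i j l x
    by (rule act_commute[OF that])
  show "act False l (i, True) (act False l (i + 1, True) (act False l (i, True) x)) =
    act False l (i + 1, True) (act False l (i, True) (act False l (i + 1, True) x))"
    if "x \<in> Xn n l" for i l x
    using act_braid[OF that T_B_commute] by simp
qed

text \<open>The order of quantifiers is the point: over each state a braid word acts as one pure
  word, common to both actions and all \<open>l\<close>. Fixed points of braid words thus reduce to
  \<open>asymp_all_fixed_points_eq\<close>.\<close>

lemma eval_word_act:
  "\<exists>\<sigma> W. \<forall>fl l st x. eval_word (act fl l) w (st, x) = (\<sigma> st, eval_word (pact fl l) (W st) x)"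
proof (induction w)
  case Nil
  show ?case by (rule exI[of _ "\<lambda>st. st"], rule exI[of _ "\<lambda>_. []"]) simp
next
  case (Cons a w)
  then obtain \<sigma> W where IH: "\<And>fl l st x. eval_word (act fl l) w (st, x) = (\<sigma> st, eval_word (pact fl l) (W st) x)" by blast
  show ?case
    by (rule exI[of _ "\<lambda>st. fst (step a (\<sigma> st))"], rule exI[of _ "\<lambda>st. snd (step a (\<sigma> st)) @ W st"])
      (simp only: eval_word_Cons eval_word_append IH, simp add: act_def)
qed

lemma act_fixed_points_eq:
  "asymp_all (Xn n) (\<lambda>l x. (eval_word (act True l) w x = x) = (eval_word (act False l) w x = x))"
proof (rule asymp_all_Times[OF finite_states finite_X1])
  fix st
  obtain \<sigma> W where e: "\<And>fl l st x. eval_word (act fl l) w (st, x) = (\<sigma> st, eval_word (pact fl l) (W st) x)"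
    using eval_word_act by blast
  show "asymp_all X1 (\<lambda>l x. (eval_word (act True l) w (st, x) = (st, x)) = (eval_word (act False l) w (st, x) = (st, x)))"
    by (rule asymp_all_mono[OF finite_X1 asymp_all_fixed_points_eq[of "W st"]]) (simp add: e)
qed

end

section \<open>The full twist and the conjugated pure braids\<close>

definition t_word :: braid_word where
  "t_word = [(2, True), (1, True), (2, True), (1, True), (2, True), (1, True)]"

definition level_word :: "nat \<Rightarrow> braid_word" where
  "level_word i = concat (replicate i [(1, False), (1, False)]) @
    [(1, False), (2, True), (2, True), (1, True)] @ concat (replicate i [(1, True), (1, True)])"

abbreviation base :: "nat set \<times> vertex" where "base \<equiv> ({1, 2, 3}, V0)"

context construction
begin

text \<open>Closed walks at \<open>V0\<close> in the hexagon: \<open>t_word\<close> makes the full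
  turn and collects only the label of the edge from \<open>V5\<close> to \<open>V0\<close>; the
  other words walk out and back.\<close>

lemma eval_word_base:
  "eval_word (act fl l) t_word (base, x) = (base, pact fl l (T, True) x)"
  "eval_word (act fl l) [(1, True), (1, True)] (base, x) = (base, pact fl l (A, True) x)"
  "eval_word (act fl l) [(1, False), (1, False)] (base, x) = (base, pact fl l (A, False) x)"
  "eval_word (act fl l) [(1, False), (2, True), (2, True), (1, True)] (base, x) = (base, pact fl l (B, True) x)"
  by (simp_all add: t_word_def act_def below_def del: pure_act.simps)

lemma eval_word_concat_replicate:
  assumes "\<And>x. eval_word (act fl l) w (base, x) = (base, pact fl l a x)"
  shows "eval_word (act fl l) (concat (replicate i w)) (base, x) = (base, eval_word (pact fl l) (replicate i a) x)"
  by (induction i) (simp_all add: assms del: One_nat_def)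

lemma eval_word_level_word:
  assumes "i < r + 2"
  shows "eval_word (act fl l) (level_word i) (base, (0, \<xi>)) = (base, (0, gen (\<pi> l) r (p l) i \<xi>))"
proof -
  have "eval_word (pact fl l) (replicate i (A, False)) (pact fl l (B, True) (eval_word (pact fl l) (replicate i (A, True)) (0, \<xi>))) =
    (0, gen (\<pi> l) r (p l) i \<xi>)"
    using eval_word_level[OF assms, of fl l \<xi>] by (simp only: eval_word_append eval_word_Cons)
  then show ?thesis unfolding level_word_def
    by (simp only: eval_word_append eval_word_concat_replicate[OF eval_word_base(2)] eval_word_concat_replicate[OF eval_word_base(3)]
        eval_word_base(4))
qed

end

lemma t_word_perm: "braid_word_perm t_word = id"
  by (auto simp: t_word_def braid_word_perm_def fun_eq_iff Transposition.transpose_def)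

lemma level_word_perm: "braid_word_perm (level_word i) = id"
proof -
  have rep: "braid_word_perm (concat (replicate i w)) = id" if "braid_word_perm w = id" for w
    by (induction i) (simp_all add: braid_word_perm_append that, simp add: braid_word_perm_def)
  have "braid_word_perm [(1, False), (1, False)] = id" "braid_word_perm [(1, True), (1, True)] = id"
    "braid_word_perm [(1, False), (2, True), (2, True), (1, True)] = id"
    by (auto simp: braid_word_perm_def fun_eq_iff Transposition.transpose_def)
  then show ?thesis unfolding level_word_def braid_word_perm_append by (simp only: rep id_o)
qed

lemma level_word_letters: "level_word i \<in> lists ({1, 2} \<times> UNIV)"
  by (auto simp: level_word_def split: if_splits)

text \<open>The full twist is the square of the half twist, which has the two words
  \<open>?D\<close> and \<open>?E\<close>. Exchanging these inside the product slides a positive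
  letter through \<open>t_word\<close>; a negative letter follows by conjugation.\<close>

lemma t_word_central:
  assumes n: "n \<ge> 3" and w: "w \<in> lists ({1, 2} \<times> UNIV)"
  shows "braid_eq n (t_word @ w) (w @ t_word)"
proof -
  let ?D = "[(1, True), (2, True), (1, True)] :: braid_word"
  let ?E = "[(2, True), (1, True), (2, True)] :: braid_word"
  have words: "u \<in> braid_words n" if "u \<in> lists ({1, 2} \<times> UNIV)" for u
    using that n by (fastforce simp: braid_words_def in_lists_conv_set)
  have tw: "t_word \<in> braid_words n" by (rule words) (simp add: t_word_def)
  have D: "braid_eq n ?D ?E" using braid_eq.braid[of 1 n] n by (simp add: numeral_2_eq_2)
  have E: "braid_eq n ?E ?D" using D by (rule braid_eq.sym)
  have r: "braid_eq n [(i, b)] [(i, b)]" if "i \<in> {1, 2}" for i b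
    by (rule braid_eq.refl, rule words) (use that in auto)
  have pos: "braid_eq n (t_word @ [(i, True)]) ([(i, True)] @ t_word)" if "i \<in> {1, 2}" for i
  proof (cases "i = 1")
    case True
    have "braid_eq n (?E @ ?D @ [(1, True)]) (?D @ ?E @ [(1, True)])"
      by (intro braid_eq.append D E r) simp
    then show ?thesis using True by (simp add: t_word_def)
  next
    case False
    have "braid_eq n ([(2, True)] @ ?D @ ?E) ([(2, True)] @ ?E @ ?D)"
      by (intro braid_eq.append D E r) simp
    then show ?thesis using False that by (simp add: t_word_def)
  qed
  have neg: "braid_eq n (t_word @ [(i, False)]) ([(i, False)] @ t_word)" if i: "i \<in> {1, 2}" for i
  proof -
    have in1: "i \<in> {1..<n}" using i n by auto
    have c1: "braid_eq n [(i, False), (i, True)] []" and c2: "braid_eq n [(i, True), (i, False)] []"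
      using braid_eq.cancel[OF in1, of False] braid_eq.cancel[OF in1, of True] by simp_all
    note t = braid_eq.refl[OF tw]
    have "braid_eq n ([(i, False), (i, True)] @ t_word @ [(i, False)]) ([] @ t_word @ [(i, False)])"
      by (intro braid_eq.append c1 t r i)
    from braid_eq.sym[OF this]
    have 1: "braid_eq n (t_word @ [(i, False)]) ([(i, False)] @ ([(i, True)] @ t_word) @ [(i, False)])"
      by simp
    have 2: "braid_eq n ([(i, False)] @ ([(i, True)] @ t_word) @ [(i, False)]) ([(i, False)] @ (t_word @ [(i, True)]) @ [(i, False)])"
      by (intro braid_eq.append r i braid_eq.sym[OF pos])
    have "braid_eq n ([(i, False)] @ t_word @ [(i, True), (i, False)]) ([(i, False)] @ t_word @ [])"
      by (intro braid_eq.append c2 t r i)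
    then have 3: "braid_eq n ([(i, False)] @ (t_word @ [(i, True)]) @ [(i, False)]) ([(i, False)] @ t_word)"
      by simp
    show ?thesis by (rule braid_eq.trans[OF 1 braid_eq.trans[OF 2 3]])
  qed
  show ?thesis using w
  proof (induction w)
    case Nil
    show ?case using braid_eq.refl[OF tw] by simp
  next
    case (Cons a w)
    obtain i b where a: "a = (i, b)" "i \<in> {1, 2}" using Cons.hyps by (cases a) auto
    have "braid_eq n (t_word @ [a]) ([a] @ t_word)" using pos neg a by (cases b) auto
    from braid_eq.append[OF this braid_eq.refl[OF words[OF Cons.hyps(2)]]]
    have 1: "braid_eq n (t_word @ a # w) ([a] @ t_word @ w)" by simp
    have 2: "braid_eq n ([a] @ t_word @ w) ([a] @ w @ t_word)"
      by (rule braid_eq.append[OF _ Cons.IH]) (use r a in simp)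
    show ?case using braid_eq.trans[OF 1 2] by simp
  qed
qed

lemma pure_class_in_carrier:
  assumes K: "K = braid_group n \<or> K = pure_braid_group n"
    and w: "w \<in> braid_words n" and id: "braid_word_perm w = id"
  shows "braid_rel n `` {w} \<in> carrier K"
  using K
proof
  assume "K = pure_braid_group n"
  then show ?thesis
    using braid_class_in_carrier[OF w] braid_perm_class[OF w] id
    by (simp add: pure_braid_group_def kernel_def sym_group_one)
qed (simp add: braid_class_in_carrier[OF w])

section \<open>Failure of rigidity for both groups\<close>

lemma not_rigid:
  assumes n: "n \<ge> 3" and K: "K = braid_group n \<or> K = pure_braid_group n"
  shows "\<not> UB_flexibly_BS_rigid K"
proof
  assume rigid: "UB_flexibly_BS_rigid K"
  \<comment> \<open>\<open>81\<close> is the first value that satisfies this bound. It is the same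
    for all \<open>l\<close>, so states and levels split the points into a fixed number of
    blocks.\<close>
  obtain r :: nat where r: "2560 < 32 * r" by (rule that[of 81]) simp
  \<comment> \<open>Exceeding \<open>l + 2\<close> makes the primes odd and lets them tend to
    infinity.\<close>
  define p where "p l = (SOME q :: nat. prime q \<and> l + 2 < q)" for l :: nat
  have "prime (p l) \<and> l + 2 < p l" for l
    unfolding p_def by (rule someI_ex[OF bigger_prime])
  then have p: "prime (p l)" "l + 2 < p l" for l by auto
  define good where "good l \<pi> \<longleftrightarrow> (\<forall>i<r. \<pi> i permutes {..<2560 * p l}) \<and>
    (\<forall>A\<subseteq>{..<2560 * p l}. (\<forall>i<r. card (\<pi> i ` A - A) \<le> p l) \<longrightarrow>
      card A < 64 * p l \<or> 2560 * p l < card A + 64 * p l)" for l \<pi>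
  define \<pi> where "\<pi> l = (SOME \<pi>. good l \<pi>)" for l
  have \<pi>: "good l (\<pi> l)" for l
  proof -
    have "\<exists>\<pi>. good l \<pi>"
      unfolding good_def by (rule ex_expanding_permutations[OF _ r]) (use p(2)[of l] in simp)
    then show ?thesis unfolding \<pi>_def by (rule someI_ex)
  qed
  have lim: "filterlim p at_top sequentially"
  proof (rule filterlim_at_top_mono[OF filterlim_ident always_eventually[OF allI]])
    show "l \<le> p l" for l using p(2)[of l] by simp
  qed
  interpret construction r p \<pi>
    using p \<pi> lim by unfold_locales (auto simp: good_def)
  have base: "base \<in> states n" using n by (auto simp: states_def)
  have pts: "points (p l) \<noteq> {}" for l
  proof -
    have "(0, 0, True, 0, 1) \<in> points (p l)" using p(2)[of l] by (simp add: points_def)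
    then show ?thesis by blast
  qed
  have ne: "Xn n l \<noteq> {}" for l using base pts[of l] by (auto simp: level_points_def)
  have card_ge: "p l \<le> card (Xn n l)" for l
  proof -
    have "card ((\<lambda>j. (base, (0 :: nat, (int j, 0 :: nat, True, 0 :: int, 1 :: int)))) ` {..<p l}) = p l"
      by (subst card_image) (auto simp: inj_on_def)
    moreover have "card ((\<lambda>j. (base, (0 :: nat, (int j, 0 :: nat, True, 0 :: int, 1 :: int)))) ` {..<p l}) \<le> card (Xn n l)"
      by (rule card_mono)
        (use finite_states finite_X1 base p(2)[of l] in \<open>auto simp: level_points_def points_def\<close>)
    ultimately show ?thesis by simp
  qed
  have lim_card: "filterlim (\<lambda>l. card (Xn n l)) at_top sequentially"
    by (rule filterlim_at_top_mono[OF lim]) (use card_ge in auto)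
  obtain \<beta> N h where \<beta>: "\<And>l. inj_on (\<beta> l) (Xn n l)"
    and h: "\<And>l. h l \<in> hom K (sym_group (N l))"
    and near: "\<And>w. w \<in> braid_words n \<Longrightarrow> braid_rel n `` {w} \<in> carrier K \<Longrightarrow>
      asymp_all (Xn n) (\<lambda>l x. h l (braid_rel n `` {w}) (\<beta> l x) = \<beta> l (eval_word (act True l) w x))"
    by (rule rigid_imp_nearby_hom[OF K almost_braid_action_act braid_action_act ne lim_card act_fixed_points_eq rigid])
      (rule that)
  have words: "u \<in> braid_words n" if "u \<in> lists ({1, 2} \<times> UNIV)" for u
    using that n by (fastforce simp: braid_words_def in_lists_conv_set)
  have tw: "t_word \<in> braid_words n" by (rule words) (simp add: t_word_def)
  have lw: "level_word i \<in> braid_words n" for i by (rule words[OF level_word_letters])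
  note tK = pure_class_in_carrier[OF K tw t_word_perm]
  note lK = pure_class_in_carrier[OF K lw level_word_perm]
  \<comment> \<open>The block over \<open>base\<close> at level 0, of fixed proportion, where
    \<open>t_word\<close> acts as \<open>shift_f\<close> and \<open>level_word i\<close> as
    generator \<open>i\<close>.\<close>
  define \<psi> where "\<psi> l \<xi> = \<beta> l (base, (0, \<xi>))" for l \<xi>
  define \<tau> where "\<tau> l = h l (braid_rel n `` {t_word})" for l
  define H where "H l i = h l (braid_rel n `` {level_word i})" for l i
  have slice: "asymp_all (\<lambda>l. points (p l)) (\<lambda>l \<xi>. P l (base, (0, \<xi>)))" if "asymp_all (Xn n) P" for P
  proof -
    have "asymp_all X1 (\<lambda>l x. P l (base, x))" by (rule asymp_all_slice[OF finite_states finite_X1 that base])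
    then show ?thesis
      unfolding level_points_def by (rule asymp_all_slice[rotated 2]) (auto simp: finite_points)
  qed
  have t: "asymp_all (\<lambda>l. points (p l)) (\<lambda>l \<xi>. \<tau> l (\<psi> l \<xi>) = \<psi> l (shift_f (p l) \<xi>))"
    by (rule asymp_all_mono[OF finite_points slice[OF near[OF tw tK]]])
      (auto simp: \<tau>_def \<psi>_def eval_word_base simp del: One_nat_def)
  have g: "asymp_all (\<lambda>l. points (p l)) (\<lambda>l \<xi>. \<forall>i\<in>{..Suc r}. H l i (\<psi> l \<xi>) = \<psi> l (gen (\<pi> l) r (p l) i \<xi>))"
  proof (rule asymp_all_ball[OF _ finite_points])
    fix i assume i: "i \<in> {..Suc r}"
    show "asymp_all (\<lambda>l. points (p l)) (\<lambda>l \<xi>. H l i (\<psi> l \<xi>) = \<psi> l (gen (\<pi> l) r (p l) i \<xi>))"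
      by (rule asymp_all_mono[OF finite_points slice[OF near[OF lw[of i] lK[of i]]]])
        (use i in \<open>simp add: H_def \<psi>_def eval_word_level_word del: gen.simps One_nat_def\<close>)
  qed simp
  have "\<forall>\<^sub>F l in sequentially. 1000000 * r * card {\<xi> \<in> points (p l).
      \<not> (\<tau> l (\<psi> l \<xi>) = \<psi> l (shift_f (p l) \<xi>) \<and>
        (\<forall>i\<in>{..Suc r}. H l i (\<psi> l \<xi>) = \<psi> l (gen (\<pi> l) r (p l) i \<xi>)))} \<le> card (points (p l))"
    by (rule asymp_all_eventually[OF asymp_all_conj[OF finite_points t g] finite_points pts])
  then obtain l where l: "1000000 * r * card {\<xi> \<in> points (p l).
      \<not> (\<tau> l (\<psi> l \<xi>) = \<psi> l (shift_f (p l) \<xi>) \<and>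
        (\<forall>i\<in>{..Suc r}. H l i (\<psi> l \<xi>) = \<psi> l (gen (\<pi> l) r (p l) i \<xi>)))} \<le> card (points (p l))"
    using eventually_happens'[OF sequentially_bot] by blast
  show False
  proof (rule no_nearby_commuting_extension[of "p l" r "\<pi> l" "\<psi> l" "\<tau> l" "H l"])
    show "prime (p l)" by (rule p)
    show "odd (p l)" using p(2)[of l] by (intro prime_odd_nat p) simp
    show "r > 0" using r by simp
    show "\<pi> l i permutes {..<2560 * p l}" if "i < r" for i using perm[OF that] .
    show "card B < 64 * p l \<or> 2560 * p l < card B + 64 * p l"
      if "B \<subseteq> {..<2560 * p l}" "\<forall>i<r. card (\<pi> l i ` B - B) \<le> p l" for B
      using \<pi>[of l] that by (simp add: good_def)
    show "inj_on (\<psi> l) (points (p l))"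
    proof (rule inj_onI)
      fix \<xi> \<xi>' assume \<xi>: "\<xi> \<in> points (p l)" "\<xi>' \<in> points (p l)" "\<psi> l \<xi> = \<psi> l \<xi>'"
      have "(base, (0 :: nat, \<xi>)) = (base, (0, \<xi>'))"
        by (rule inj_onD[OF \<beta>[of l] \<xi>(3)[unfolded \<psi>_def]])
          (use \<xi> base in \<open>auto simp: level_points_def simp del: One_nat_def\<close>)
      then show "\<xi> = \<xi>'" by simp
    qed
    \<comment> \<open>Here the homomorphism property enters: the full twist commutes with the level
      words in the group, so their images commute at every point of the larger set.\<close>
    show "\<tau> l (H l i x) = H l i (\<tau> l x)" for i x
    proof -
      have Km: "mult K = mult (braid_group n)" using K by (auto simp: pure_braid_group_def)
      have "\<tau> l \<circ> H l i = h l (braid_rel n `` {t_word @ level_word i})"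
        using hom_mult[OF h tK lK, of l i] braid_group_mult[OF tw lw]
        by (simp add: \<tau>_def H_def sym_group_mult Km)
      also have "braid_rel n `` {t_word @ level_word i} = braid_rel n `` {level_word i @ t_word}"
        by (rule braid_class_eqI[OF t_word_central[OF n level_word_letters]])
      also have "h l \<dots> = H l i \<circ> \<tau> l"
        using hom_mult[OF h lK tK, of l i] braid_group_mult[OF lw tw]
        by (simp add: \<tau>_def H_def sym_group_mult Km)
      finally show ?thesis by (simp add: fun_eq_iff)
    qed
    have "{x \<in> points (p l). \<tau> l (\<psi> l x) \<noteq> \<psi> l (shift_f (p l) x) \<or>
        (\<exists>i\<le>Suc r. H l i (\<psi> l x) \<noteq> \<psi> l (gen (\<pi> l) r (p l) i x))} =
      {\<xi> \<in> points (p l). \<not> (\<tau> l (\<psi> l \<xi>) = \<psi> l (shift_f (p l) \<xi>) \<and>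
        (\<forall>i\<in>{..Suc r}. H l i (\<psi> l \<xi>) = \<psi> l (gen (\<pi> l) r (p l) i \<xi>)))}"
      by (auto simp del: gen.simps shift_f.simps)
    then show "1000000 * r * card {x \<in> points (p l). \<tau> l (\<psi> l x) \<noteq> \<psi> l (shift_f (p l) x) \<or>
        (\<exists>i\<le>Suc r. H l i (\<psi> l x) \<noteq> \<psi> l (gen (\<pi> l) r (p l) i x))} \<le> card (points (p l))"
      using l by simp
  qed
qed

theorem proposition1p31:
  fixes n :: nat
  assumes "n \<ge> 3"
  shows "\<not> UB_flexibly_BS_rigid (braid_group n) \<and> \<not> UB_flexibly_BS_rigid (pure_braid_group n)"
  using not_rigid[OF assms] by blast

end
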